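(* Let $G$ be a countable residually finite group, let $k\in\mathbb N$, and let $H_1\supseteq H_2\supseteq\cdots$ be a decreasing sequence of finite-index normal subgroups of $G$ with $\bigcap_{n}H_n=\{e\}$. Let $x\in\{1,\dots,k\}^G$ be a Toeplitz element with respect to $\{H_n\}_{n\in\mathbb N}$ and put $X=\overline{Gx}$ (the orbit closure of $x$). Then for every sofic approximation by homomorphisms $\Sigma=\{\sigma_n\colon G\to \mathrm{Sym}(V_n)\}_{n\in\mathbb N}$ of $G$ such that $\ker\sigma_n\subseteq H_n$ for every $n\in\mathbb N$ one has $$h_\Sigma(X,G)\le\liminf_{n\to\infty}\frac1{[G:H_n]}\sum_{v\in G/H_n}\log|x(v)|\le\lim_{n\to\infty}\frac{\#\mathrm{Per}_{H_n}(x,* )}{[G:H_n]}\log k,$$ where for a coset $v\in G/H_n$, $x(v)=\{x_g: g\in v\}$ is the image of the set $v$ under $x\colon G\to\{1,\dots,k\}$. Additionally, if $G=\langle S\rangle$ is a free group freely generated by a finite set $S$, then the inequality holds for every sofic approximation $\Sigma=\{\sigma_n\}_{n\in\mathbb N}$ of $G$ (not necessarily by homomorphisms) such that $\mathrm{Stab}\,\sigma_n\subseteq H_n$ for every $n\in\mathbb N$.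
   Context: $\mathbb N=\{1,2,\dots\}$; $e$ is the neutral element of $G$; $\mathrm{Sym}(V)$ is the group of bijections of a set $V$. "Decreasing" for a sequence of subgroups means $H_{n+1}\subseteq H_n$ for all $n$ (not necessarily strictly). Sofic approximation: a sequence $\Sigma=\{\sigma_n\colon G\to\mathrm{Sym}(V_n)\}_{n\in\mathbb N}$ of maps, with $V_n$ finite sets, $\sigma_{n,s}:=\sigma_n(s)$, such that (S1) $|\{v\in V_n:\sigma_{n,st}(v)=\sigma_{n,s}\sigma_{n,t}(v)\}|/|V_n|\to1$ for all $s,t\in G$, and (S2) $|\{v\in V_n:\sigma_{n,s}(v)\ne\sigma_{n,t}(v)\}|/|V_n|\to1$ for all distinct $s,t\in G$. It is a sofic approximation by homomorphisms if every $\sigma_n$ is a group homomorphism. Sofic topological entropy: let $G$ act continuously on a compact metrizable space $X$, and let $d\le 1$ be a continuous pseudometric on $X$ that is dynamically generating (for distinct $x,y\in X$ there is $s\in G$ with $d(sx,sy)>0$). For maps $\varphi,\psi\colon V\to X$ from a finite set put $d_2(\varphi,\psi)=\big(\frac1{|V|}\sum_{v\in V}d(\varphi(v),\psi(v))^2\big)^{1/2}$ and $d_\infty(\varphi,\psi)=\max_{v\in V}d(\varphi(v),\psi(v))$. For finite $F\subset G$, $\delta>0$ and $\sigma\colon G\to\mathrm{Sym}(V)$, $\mathrm{Map}(d,F,\delta,\sigma)$ is the set of $\varphi\colon V\to X$ with $d_2(\varphi\sigma_s,s\varphi)\le\delta$ for all $s\in F$, where $(s\varphi)(v)=s(\varphi(v))$.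 $N_\epsilon(Y,\rho)$ is the maximal cardinality of a subset of $Y$ whose distinct points are at $\rho$-distance $>\epsilon$. Then $$h_\Sigma(X,G)=\sup_{\epsilon>0}\inf_{F\subset G\text{ finite}}\inf_{\delta>0}\limsup_{n\to\infty}\frac1{|V_n|}\log N_\epsilon(\mathrm{Map}(d,F,\delta,\sigma_n),d_\infty),$$ with $\log0=-\infty$; this value does not depend on the choice of $d$. Shift: $\{1,\dots,k\}^G$ has the product topology and the action $(gx)_h=x_{g^{-1}h}$. Toeplitz elements: for a normal subgroup $H$ of $G$ and $x\in\{1,\dots,k\}^G$, $\mathrm{Per}_H(x)=\{g\in G: x_{h^{-1}g}=x_g\text{ for all }h\in H\}$ (the union of the cosets of $H$ on which $x$ is constant). $\#\mathrm{Per}_H(x,* )$ is the number of cosets of $H$ on which $x$ is not constant (the $H$-holes, i.e. cosets not contained in $\mathrm{Per}_H(x)$). $x$ is a Toeplitz element with respect to a decreasing sequence $\{H_n\}$ of finite-index subgroups if $G=\bigcup_n\mathrm{Per}_{H_n}(x)$. Stabilizers for the free group $G=\langle S\rangle$: $\mathrm{Stab}\,\sigma_n=\bigcap_{v\in V_n}\mathrm{Stab}_{\sigma_n}(v)$, where $\mathrm{Stab}_{\sigma_n}(v)$ is the set of $g\in G$ such that, writing $g=\prod_{i=1}^m s_i^{\alpha_i}$ as a reduced word ($s_i\in S$, $\alpha_i$ nonzero integers), $\sigma_n(s_1)^{\alpha_1}\circ\cdots\circ\sigma_n(s_m)^{\alpha_m}v=v$.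
   Formalization: The countable group G is assumed infinite: for finite G and nonconstant x the claim fails, e.g. G = Z/2, H_n = {e}, x = (1,2), σ_n left translation on V_n = G gives h = (log 2)/2 > 0 while the bound is 0. *)

theory Defs
  imports "HOL-Analysis.Analysis" "HOL-Algebra.Coset" "HOL-Algebra.Bij"
begin

definition residually_finite :: "('a, 'b) monoid_scheme \<Rightarrow> bool" where
  "residually_finite G \<longleftrightarrow>
     (\<forall>g\<in>carrier G. g \<noteq> \<one>\<^bsub>G\<^esub> \<longrightarrow> (\<exists>N. N \<lhd> G \<and> finite (rcosets\<^bsub>G\<^esub> N) \<and> g \<notin> N))"

text \<open>
  A word is a list of syllables (generator, exponent).  A set generates freely if every group
  element has a unique reduced representation.
\<close>

definition reduced_words :: "'a set \<Rightarrow> ('a \<times> int) list set" where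
  "reduced_words S = {w. (\<forall>(s, a)\<in>set w. s \<in> S \<and> a \<noteq> 0) \<and>
     (\<forall>i. Suc i < length w \<longrightarrow> fst (w ! i) \<noteq> fst (w ! Suc i))}"

definition word_eval :: "('c, 'd) monoid_scheme \<Rightarrow> ('a \<Rightarrow> 'c) \<Rightarrow> ('a \<times> int) list \<Rightarrow> 'c" where
  "word_eval M f w = foldr (\<lambda>(s, a) p. (f s [^]\<^bsub>M\<^esub> a) \<otimes>\<^bsub>M\<^esub> p) w \<one>\<^bsub>M\<^esub>"

definition freely_generated :: "('a, 'b) monoid_scheme \<Rightarrow> 'a set \<Rightarrow> bool" where
  "freely_generated G S \<longleftrightarrow> S \<subseteq> carrier G \<and>
     bij_betw (word_eval G (\<lambda>s. s)) (reduced_words S) (carrier G)"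

text \<open>
  Sofic approximations.  \<open>Sym(V)\<close> is the library's \<open>BijGroup V\<close>, whose elements are the
  bijections of \<open>V\<close> extended by \<open>undefined\<close> outside \<open>V\<close>.  The sets \<open>V n\<close> are not required to
  be nonempty: since \<open>0 / 0 = 0\<close>, the first limit makes them nonempty for all large \<open>n\<close>.
\<close>

definition sofic_approximation ::
  "('a, 'b) monoid_scheme \<Rightarrow> (nat \<Rightarrow> 'v set) \<Rightarrow> (nat \<Rightarrow> 'a \<Rightarrow> 'v \<Rightarrow> 'v) \<Rightarrow> bool" where
  "sofic_approximation G V \<sigma> \<longleftrightarrow>
     (\<forall>n. finite (V n)) \<and>
     (\<forall>n. \<sigma> n \<in> carrier G \<rightarrow> carrier (BijGroup (V n))) \<and>
     (\<forall>s\<in>carrier G. \<forall>t\<in>carrier G.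
        (\<lambda>n. real (card {v \<in> V n. \<sigma> n (s \<otimes>\<^bsub>G\<^esub> t) v = \<sigma> n s (\<sigma> n t v)}) / real (card (V n)))
          \<longlonglongrightarrow> 1) \<and>
     (\<forall>s\<in>carrier G. \<forall>t\<in>carrier G. s \<noteq> t \<longrightarrow>
        (\<lambda>n. real (card {v \<in> V n. \<sigma> n s v \<noteq> \<sigma> n t v}) / real (card (V n))) \<longlonglongrightarrow> 1)"

definition sofic_approximation_by_homs ::
  "('a, 'b) monoid_scheme \<Rightarrow> (nat \<Rightarrow> 'v set) \<Rightarrow> (nat \<Rightarrow> 'a \<Rightarrow> 'v \<Rightarrow> 'v) \<Rightarrow> bool" where
  "sofic_approximation_by_homs G V \<sigma> \<longleftrightarrow>
     sofic_approximation G V \<sigma> \<and> (\<forall>n. \<sigma> n \<in> hom G (BijGroup (V n)))"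

text \<open>
  Stabilizers of a map \<open>\<tau> : G \<rightarrow> Sym(V)\<close> on a group freely generated by \<open>S\<close>; only the values
  of \<open>\<tau>\<close> on \<open>S\<close> matter, and \<open>w\<close> below is the unique reduced word representing \<open>g\<close>.
\<close>

definition vertex_stabilizer ::
  "('a, 'b) monoid_scheme \<Rightarrow> 'a set \<Rightarrow> 'v set \<Rightarrow> ('a \<Rightarrow> 'v \<Rightarrow> 'v) \<Rightarrow> 'v \<Rightarrow> 'a set" where
  "vertex_stabilizer G S V \<tau> v = {g \<in> carrier G. \<exists>w\<in>reduced_words S.
     word_eval G (\<lambda>s. s) w = g \<and> word_eval (BijGroup V) \<tau> w v = v}"

definition stabilizer ::
  "('a, 'b) monoid_scheme \<Rightarrow> 'a set \<Rightarrow> 'v set \<Rightarrow> ('a \<Rightarrow> 'v \<Rightarrow> 'v) \<Rightarrow> 'a set" where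
  "stabilizer G S V \<tau> = carrier G \<inter> (\<Inter>v\<in>V. vertex_stabilizer G S V \<tau> v)"

definition continuous_pseudometric :: "'x topology \<Rightarrow> ('x \<Rightarrow> 'x \<Rightarrow> real) \<Rightarrow> bool" where
  "continuous_pseudometric X d \<longleftrightarrow>
     (\<forall>y\<in>topspace X. d y y = 0) \<and>
     (\<forall>y\<in>topspace X. \<forall>z\<in>topspace X. 0 \<le> d y z \<and> d y z = d z y) \<and>
     (\<forall>y\<in>topspace X. \<forall>z\<in>topspace X. \<forall>w\<in>topspace X. d y w \<le> d y z + d z w) \<and>
     continuous_map (prod_topology X X) euclideanreal (\<lambda>(y, z). d y z)"

definition dynamically_generating ::
  "('a, 'b) monoid_scheme \<Rightarrow> 'x topology \<Rightarrow> ('a \<Rightarrow> 'x \<Rightarrow> 'x) \<Rightarrow> ('x \<Rightarrow> 'x \<Rightarrow> real) \<Rightarrow> bool" where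
  "dynamically_generating G X act d \<longleftrightarrow>
     (\<forall>y\<in>topspace X. \<forall>z\<in>topspace X. y \<noteq> z \<longrightarrow> (\<exists>s\<in>carrier G. d (act s y) (act s z) > 0))"

definition d2 :: "'v set \<Rightarrow> ('x \<Rightarrow> 'x \<Rightarrow> real) \<Rightarrow> ('v \<Rightarrow> 'x) \<Rightarrow> ('v \<Rightarrow> 'x) \<Rightarrow> real" where
  "d2 V d \<phi> \<psi> = sqrt ((\<Sum>v\<in>V. (d (\<phi> v) (\<psi> v))\<^sup>2) / real (card V))"

definition dinf :: "'v set \<Rightarrow> ('x \<Rightarrow> 'x \<Rightarrow> real) \<Rightarrow> ('v \<Rightarrow> 'x) \<Rightarrow> ('v \<Rightarrow> 'x) \<Rightarrow> real" where
  "dinf V d \<phi> \<psi> = Max ((\<lambda>v. d (\<phi> v) (\<psi> v)) ` V)"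

definition sofic_maps ::
  "'x topology \<Rightarrow> ('a \<Rightarrow> 'x \<Rightarrow> 'x) \<Rightarrow> ('x \<Rightarrow> 'x \<Rightarrow> real) \<Rightarrow> 'a set \<Rightarrow> real \<Rightarrow>
   'v set \<Rightarrow> ('a \<Rightarrow> 'v \<Rightarrow> 'v) \<Rightarrow> ('v \<Rightarrow> 'x) set" where
  "sofic_maps X act d F \<delta> V \<tau> = {\<phi> \<in> V \<rightarrow>\<^sub>E topspace X.
     \<forall>s\<in>F. d2 V d (\<lambda>v. \<phi> (\<tau> s v)) (\<lambda>v. act s (\<phi> v)) \<le> \<delta>}"

text \<open>
  The separation number takes values in \<open>enat\<close>, so that no finiteness is built into it; finite
  subsets suffice because every subset of a separated set is separated.
\<close>

definition separation_number :: "real \<Rightarrow> 'y set \<Rightarrow> ('y \<Rightarrow> 'y \<Rightarrow> real) \<Rightarrow> enat" where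
  "separation_number \<epsilon> Y \<rho> =
     (SUP A\<in>{A. A \<subseteq> Y \<and> finite A \<and> (\<forall>y\<in>A. \<forall>z\<in>A. y \<noteq> z \<longrightarrow> \<rho> y z > \<epsilon>)}. enat (card A))"

definition log_enat :: "enat \<Rightarrow> ereal" where
  "log_enat N = (case N of enat m \<Rightarrow> (if m = 0 then - \<infinity> else ereal (ln (real m))) | \<infinity> \<Rightarrow> \<infinity>)"

text \<open>
  The value does not depend on the choice of the dynamically generating continuous pseudometric
  \<open>d\<close>; instead of fixing one by a choice operator, \<open>d\<close> is kept as a parameter, over which results
  are to be quantified universally.
\<close>

definition sofic_entropy ::
  "('a, 'b) monoid_scheme \<Rightarrow> 'x topology \<Rightarrow> ('a \<Rightarrow> 'x \<Rightarrow> 'x) \<Rightarrow> ('x \<Rightarrow> 'x \<Rightarrow> real) \<Rightarrow>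
   (nat \<Rightarrow> 'v set) \<Rightarrow> (nat \<Rightarrow> 'a \<Rightarrow> 'v \<Rightarrow> 'v) \<Rightarrow> ereal" where
  "sofic_entropy G X act d V \<sigma> =
     (SUP \<epsilon>\<in>{0<..}. INF F\<in>{F. finite F \<and> F \<subseteq> carrier G}. INF \<delta>\<in>{0<..}.
        limsup (\<lambda>n. log_enat (separation_number \<epsilon> (sofic_maps X act d F \<delta> (V n) (\<sigma> n)) (dinf (V n) d))
                      / ereal (real (card (V n)))))"

text \<open>
  The full shift \<open>{1..k}\<^sup>G\<close>; its points are functions on \<open>carrier G\<close>, extended by \<open>undefined\<close>.
\<close>

definition full_shift :: "('a, 'b) monoid_scheme \<Rightarrow> nat \<Rightarrow> ('a \<Rightarrow> nat) topology" where
  "full_shift G k = product_topology (\<lambda>_. discrete_topology {1..k}) (carrier G)"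

definition shift :: "('a, 'b) monoid_scheme \<Rightarrow> 'a \<Rightarrow> ('a \<Rightarrow> nat) \<Rightarrow> ('a \<Rightarrow> nat)" where
  "shift G g x = (\<lambda>h\<in>carrier G. x (inv\<^bsub>G\<^esub> g \<otimes>\<^bsub>G\<^esub> h))"

definition orbit_closure ::
  "('a, 'b) monoid_scheme \<Rightarrow> nat \<Rightarrow> ('a \<Rightarrow> nat) \<Rightarrow> ('a \<Rightarrow> nat) topology" where
  "orbit_closure G k x = subtopology (full_shift G k)
     (full_shift G k closure_of ((\<lambda>g. shift G g x) ` carrier G))"

definition Per :: "('a, 'b) monoid_scheme \<Rightarrow> 'a set \<Rightarrow> ('a \<Rightarrow> nat) \<Rightarrow> 'a set" where
  "Per G H x = {g \<in> carrier G. \<forall>h\<in>H. x (inv\<^bsub>G\<^esub> h \<otimes>\<^bsub>G\<^esub> g) = x g}"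

text \<open>\<open>Per\<close> is a union of right cosets; for normal \<open>H\<close> these are also the left cosets.\<close>

definition num_holes :: "('a, 'b) monoid_scheme \<Rightarrow> 'a set \<Rightarrow> ('a \<Rightarrow> nat) \<Rightarrow> nat" where
  "num_holes G H x = card {v \<in> rcosets\<^bsub>G\<^esub> H. \<not> v \<subseteq> Per G H x}"

definition toeplitz :: "('a, 'b) monoid_scheme \<Rightarrow> (nat \<Rightarrow> 'a set) \<Rightarrow> ('a \<Rightarrow> nat) \<Rightarrow> bool" where
  "toeplitz G H x \<longleftrightarrow> carrier G = (\<Union>n. Per G (H n) x)"

end

theory Submission
  imports Defs
begin

text \<open>
  Fix a level \<open>m\<close> and write \<open>N = H m\<close>.  A point \<open>y\<close> of the orbit closure \<open>X\<close> has on every coset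
  \<open>w\<close> of \<open>N\<close> a set of values \<open>y ` w\<close>, and the claim is that the entropy is at most the average of
  \<open>ln (card (x ` w))\<close> over the cosets.  As this holds for each \<open>m\<close>, the limit inferior follows.

  A Toeplitz element is uniformly recurrent: each of its finite patterns reappears at bounded
  distance in every point of \<open>X\<close>.  Hence the value sets of any \<open>y\<close> are, up to a translation of the
  cosets, those of \<open>x\<close>; in particular they have the same average of \<open>ln \<circ> card\<close>, and they can be read
  off from the restriction of \<open>y\<close> to one finite window (\<open>uniform_witness\<close>).  By compactness, an approximately
  equivariant map \<open>\<phi> : V \<rightarrow> X\<close> respects the shift on any given finite window at all but a small
  proportion of the vertices (\<open>few_defects\<close>).  So the value sets of the points \<open>\<phi> v\<close> are permuted
  by the group in the expected way, and averaging over the cosets shows that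
  \<open>\<Sum>v\<in>V. ln (card (\<phi> v ` N))\<close> is at most \<open>card V\<close> times the average, up to a small error
  (\<open>sum_ln_values_le\<close>).  The symbol \<open>\<phi> v \<one>\<close> lies in \<open>\<phi> v ` N\<close>.  Therefore, once the value sets are
  known, the number of possible symbol patterns is the exponential of that sum, and the symbols
  determine \<open>\<phi>\<close> up to \<open>\<epsilon>\<close> and few exceptional vertices.

  It remains to see that the value sets carry no exponential amount of information, and this is where
  \<open>G\<close> is infinite.  Choose a large finite \<open>W \<subseteq> G\<close>.  At most vertices \<open>v\<close> the translate \<open>W v\<close> has
  \<open>card W\<close> elements, so a maximal family \<open>A\<close> of vertices with disjoint translates has at most
  \<open>card V / card W\<close> members.  By maximality \<open>W v\<close> meets some \<open>W a\<close> with \<open>a \<in> A\<close>, and equivariance carries the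
  value sets of \<open>\<phi> a\<close> to those of \<open>\<phi> v\<close>.  It suffices to record \<open>\<phi>\<close> on \<open>A\<close> and at the
  exceptional vertices, and there are only subexponentially many such sparse records
  (\<open>few_sparse_functions\<close>).  The count is \<open>card_separated_models\<close>, and the resulting bound
  \<open>sofic_entropy_le_coset_average\<close> speaks of an arbitrary sofic approximation, so it serves both parts
  of the theorem.

  For the second inequality, \<open>x\<close> has one value on a coset that is not a hole and at most \<open>k\<close> values
  on a hole, which bounds the coset average by \<open>ln k\<close> times the hole density.  The hole density
  converges because it decreases: a hole at a finer level lies inside a hole of the coarser level.
\<close>

section \<open>Sparse functions and disjoint translates\<close>

text \<open>
  Give a function \<open>b\<close> the weight \<open>lam ^ card {v\<in>V. b v \<noteq> z}\<close>.  The weights of all functions sum to a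
  \<open>card V\<close>-th power, because the sum factors over the points of \<open>V\<close>, and a sparse function has a large
  weight.
\<close>

lemma weighted_sparse_count:
  fixes V :: "'v set" and D :: "'b set" and lam \<theta> :: real
  assumes V: "finite V" and D: "finite D" and lam: "0 < lam" "lam \<le> 1"
  shows "real (card {b \<in> V \<rightarrow>\<^sub>E D. real (card {v\<in>V. b v \<noteq> z}) \<le> \<theta> * real (card V)}) * lam powr (\<theta> * real (card V))
           \<le> (1 + real (card D) * lam) ^ card V"
proof -
  let ?B = "{b \<in> V \<rightarrow>\<^sub>E D. real (card {v\<in>V. b v \<noteq> z}) \<le> \<theta> * real (card V)}"
  let ?f = "\<lambda>c. if c = z then 1 else lam"
  have fin: "finite (V \<rightarrow>\<^sub>E D)" using V D by (simp add: finite_PiE)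
  have weight: "(\<Prod>v\<in>V. ?f (b v)) = lam ^ card {v\<in>V. b v \<noteq> z}" for b
  proof -
    have "(\<Prod>v\<in>V. ?f (b v)) = (\<Prod>v\<in>{v\<in>V. b v \<noteq> z}. lam)"
      by (rule prod.mono_neutral_cong_right) (use V in auto)
    then show ?thesis by simp
  qed
  have "real (card ?B) * lam powr (\<theta> * real (card V)) = (\<Sum>b\<in>?B. lam powr (\<theta> * real (card V)))"
    by simp
  also have "\<dots> \<le> (\<Sum>b\<in>?B. lam ^ card {v\<in>V. b v \<noteq> z})"
  proof (rule sum_mono)
    fix b assume "b \<in> ?B"
    then have "lam powr (\<theta> * real (card V)) \<le> lam powr (real (card {v\<in>V. b v \<noteq> z}))"
      using lam by (intro powr_mono') auto
    then show "lam powr (\<theta> * real (card V)) \<le> lam ^ card {v\<in>V. b v \<noteq> z}"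
      using lam by (simp add: powr_realpow)
  qed
  also have "\<dots> \<le> (\<Sum>b\<in>V \<rightarrow>\<^sub>E D. lam ^ card {v\<in>V. b v \<noteq> z})"
    using fin lam by (intro sum_mono2) auto
  also have "\<dots> = (\<Sum>b\<in>V \<rightarrow>\<^sub>E D. \<Prod>v\<in>V. ?f (b v))" by (simp add: weight)
  also have "\<dots> = (\<Prod>v\<in>V. \<Sum>c\<in>D. ?f c)"
    using V D by (subst prod_sum_PiE) auto
  also have "\<dots> = (\<Sum>c\<in>D. ?f c) ^ card V" by simp
  also have "\<dots> \<le> (1 + real (card D) * lam) ^ card V"
  proof (rule power_mono)
    have "(\<Sum>c\<in>D. ?f c) \<le> (\<Sum>c\<in>D. (if c = z then 1 else 0) + lam)"
      using lam by (intro sum_mono) auto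
    also have "\<dots> = (\<Sum>c\<in>D. if c = z then 1 else 0) + real (card D) * lam"
      by (simp add: sum.distrib)
    also have "\<dots> \<le> 1 + real (card D) * lam" using D by simp
    finally show "(\<Sum>c\<in>D. ?f c) \<le> 1 + real (card D) * lam" .
    show "0 \<le> (\<Sum>c\<in>D. ?f c)" using lam by (intro sum_nonneg) auto
  qed
  finally show ?thesis .
qed

text \<open>
  The weight \<open>lam\<close> is taken so small that \<open>1 + card D * lam\<close> is at most \<open>exp (\<eta> / 2)\<close>; then \<open>\<theta>\<close> is taken
  so small that a sparse function has weight at least \<open>exp (- \<eta> / 2 * card V)\<close>.  Only \<open>card D\<close> and \<open>\<eta>\<close>
  enter, so one \<open>\<theta>\<close> serves all \<open>V\<close>.
\<close>

lemma few_sparse_functions: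
  fixes D :: "'b set" and \<eta> :: real
  assumes D: "finite D" and \<eta>: "\<eta> > 0"
  shows "\<exists>\<theta>>0. \<forall>V :: 'v set. finite V \<longrightarrow>
       real (card {b \<in> V \<rightarrow>\<^sub>E D. real (card {v\<in>V. b v \<noteq> z}) \<le> \<theta> * real (card V)}) \<le> exp (\<eta> * real (card V))"
proof -
  define lam where "lam = min (1/2) (\<eta> / (2 * (real (card D) + 1)))"
  have lam: "0 < lam" "lam < 1" using \<eta> by (auto simp: lam_def)
  have "real (card D) * lam \<le> (real (card D) + 1) * (\<eta> / (2 * (real (card D) + 1)))"
    using lam by (intro mult_mono) (auto simp: lam_def)
  also have "\<dots> = \<eta> / 2" by (simp add: divide_simps add_eq_0_iff)
  finally have Dlam: "real (card D) * lam \<le> \<eta> / 2" .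
  define \<theta> where "\<theta> = \<eta> / 2 / (- ln lam)"
  have ln: "ln lam < 0" using lam by simp
  have "\<theta> > 0" unfolding \<theta>_def using ln \<eta> by (intro divide_pos_pos) auto
  moreover have "real (card {b \<in> V \<rightarrow>\<^sub>E D. real (card {v\<in>V. b v \<noteq> z}) \<le> \<theta> * real (card V)}) \<le> exp (\<eta> * real (card V))"
    if V: "finite V" for V :: "'v set"
  proof -
    let ?c = "real (card {b \<in> V \<rightarrow>\<^sub>E D. real (card {v\<in>V. b v \<noteq> z}) \<le> \<theta> * real (card V)})"
    have "lam powr (\<theta> * real (card V)) = exp (- (\<eta> / 2 * real (card V)))"
      using lam ln by (simp add: powr_def \<theta>_def field_simps)
    then have "?c * exp (- (\<eta> / 2 * real (card V))) \<le> (1 + real (card D) * lam) ^ card V"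
      using weighted_sparse_count[OF V D, of lam z \<theta>] lam by simp
    also have "\<dots> \<le> (exp (\<eta> / 2)) ^ card V"
    proof (rule power_mono)
      show "1 + real (card D) * lam \<le> exp (\<eta> / 2)"
        using exp_ge_add_one_self[of "\<eta> / 2"] Dlam by linarith
    qed (use lam in auto)
    also have "\<dots> = exp (\<eta> / 2 * real (card V))" by (simp add: exp_of_nat_mult[symmetric] mult.commute)
    finally have "?c \<le> exp (\<eta> / 2 * real (card V)) * exp (\<eta> / 2 * real (card V))"
      by (simp add: exp_minus field_simps)
    then show ?thesis by (simp flip: exp_add)
  qed
  ultimately show ?thesis by blast
qed

text \<open>
  Disjoint translates of size \<open>card W\<close> fill at most \<open>V\<close>, which bounds their number.  A vertex whose
  translate avoided all of them could be added to a maximal family.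
\<close>

lemma maximal_disjoint_translates:
  fixes \<tau> :: "'s \<Rightarrow> 'v \<Rightarrow> 'v"
  assumes V: "finite V" and W: "finite W" "W \<noteq> {}"
    and \<tau>: "\<And>s v. s \<in> W \<Longrightarrow> v \<in> V \<Longrightarrow> \<tau> s v \<in> V"
    and inj: "\<And>v. v \<in> V - U \<Longrightarrow> inj_on (\<lambda>s. \<tau> s v) W"
  obtains A where "A \<subseteq> V - U" "card A * card W \<le> card V"
    "\<And>v. v \<in> V - U \<Longrightarrow> \<exists>a\<in>A. \<exists>s\<in>W. \<exists>t\<in>W. \<tau> s v = \<tau> t a"
proof -
  let ?T = "\<lambda>v. (\<lambda>s. \<tau> s v) ` W"
  define \<A> where "\<A> = {A. A \<subseteq> V - U \<and> (\<forall>a\<in>A. \<forall>b\<in>A. a \<noteq> b \<longrightarrow> ?T a \<inter> ?T b = {})}"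
  have "finite \<A>" unfolding \<A>_def by (rule finite_subset[of _ "Pow V"]) (use V in auto)
  moreover have "{} \<in> \<A>" by (simp add: \<A>_def)
  ultimately obtain A where A: "A \<in> \<A>" and max: "\<And>B. B \<in> \<A> \<Longrightarrow> A \<subseteq> B \<Longrightarrow> A = B"
    using finite_has_maximal2 by metis
  have AV: "A \<subseteq> V - U" and disj: "\<And>a b. a \<in> A \<Longrightarrow> b \<in> A \<Longrightarrow> a \<noteq> b \<Longrightarrow> ?T a \<inter> ?T b = {}"
    using A by (auto simp: \<A>_def)
  have finA: "finite A" using AV V by (meson finite_Diff finite_subset)
  have "card (\<Union>a\<in>A. ?T a) = (\<Sum>a\<in>A. card (?T a))"
    using finA W disj by (intro card_UN_disjoint) auto
  also have "\<dots> = (\<Sum>a\<in>A. card W)"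
    using AV inj by (intro sum.cong card_image) auto
  finally have "card A * card W = card (\<Union>a\<in>A. ?T a)" by simp
  also have "\<dots> \<le> card V" using AV \<tau> V by (intro card_mono) auto
  finally have "card A * card W \<le> card V" .
  moreover have "\<exists>a\<in>A. \<exists>s\<in>W. \<exists>t\<in>W. \<tau> s v = \<tau> t a" if v: "v \<in> V - U" for v
  proof (rule ccontr)
    assume no: "\<not> ?thesis"
    then have disjv: "?T v \<inter> ?T a = {}" if "a \<in> A" for a using that by blast
    have "insert v A \<in> \<A>" using v AV disj disjv by (auto simp: \<A>_def) blast+
    then have "v \<in> A" using max by blast
    then show False using disjv W by blast
  qed
  ultimately show thesis using that AV by blast
qed

text \<open>
  Exceptional vertices in \<open>B\<close> spoil the transfer of information to all \<open>v\<close> whose translate meets that of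
  a point of \<open>B\<close>.  For given \<open>s\<close>, \<open>t\<close> and \<open>a\<close>, the equation \<open>\<tau> s v = \<tau> t a\<close> has at most one solution.
\<close>

lemma sparse_tile_overlaps:
  fixes \<tau> :: "'s \<Rightarrow> 'v \<Rightarrow> 'v"
  assumes V: "finite V" and W: "finite W" and inj: "\<And>s. s \<in> W \<Longrightarrow> inj_on (\<tau> s) V" and B: "B \<subseteq> V"
  shows "card {v\<in>V. \<exists>s\<in>W. \<exists>t\<in>W. \<exists>a\<in>B. \<tau> s v = \<tau> t a} \<le> (card W)\<^sup>2 * card B"
proof -
  have finB: "finite B" using B V finite_subset by blast
  let ?P = "W \<times> W \<times> B"
  let ?f = "\<lambda>(s, t, a). {v\<in>V. \<tau> s v = \<tau> t a}"
  have "{v\<in>V. \<exists>s\<in>W. \<exists>t\<in>W. \<exists>a\<in>B. \<tau> s v = \<tau> t a} = (\<Union>p\<in>?P. ?f p)" by auto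
  also have "card \<dots> \<le> (\<Sum>p\<in>?P. card (?f p))" using W finB by (intro card_UN_le) auto
  also have "\<dots> \<le> (\<Sum>p\<in>?P. 1)"
  proof (rule sum_mono)
    fix p assume "p \<in> ?P"
    then obtain s t a where p: "p = (s, t, a)" "s \<in> W" by auto
    have "\<And>u v. u \<in> ?f p \<Longrightarrow> v \<in> ?f p \<Longrightarrow> u = v"
      using inj[OF p(2)] p(1) by (auto simp: inj_on_def)
    moreover have "finite (?f p)" using V p(1) by simp
    ultimately have "card (?f p) \<le> Suc 0" unfolding card_le_Suc0_iff_eq[OF \<open>finite (?f p)\<close>] by blast
    then show "card (?f p) \<le> 1" by simp
  qed
  also have "\<dots> = (card W)\<^sup>2 * card B" by (simp add: card_cartesian_product power2_eq_square)
  finally show ?thesis .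
qed

section \<open>Cosets of a normal subgroup of finite index\<close>

context normal
begin

lemma rcoset_eq_lcos_iff: "w \<in> rcosets H \<longleftrightarrow> (\<exists>a\<in>carrier G. w = a <# H)"
  using coset_eq by (auto simp: RCOSETS_def)

lemma lcos_rcosets:
  assumes "g \<in> carrier G" "w \<in> rcosets H"
  shows "g <# w \<in> rcosets H"
proof -
  obtain a where a: "a \<in> carrier G" "w = a <# H" using assms rcoset_eq_lcos_iff by auto
  then have "g <# w = (g \<otimes> a) <# H" using assms subset by (simp add: lcos_m_assoc)
  then show ?thesis using a assms rcoset_eq_lcos_iff by blast
qed

lemma sum_lcos:
  assumes g: "g \<in> carrier G"
  shows "(\<Sum>w\<in>rcosets H. f (g <# w)) = (\<Sum>w\<in>rcosets H. f w)"
proof (rule sum.reindex_bij_witness[where i = "\<lambda>w. inv g <# w" and j = "\<lambda>w. g <# w"])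
  fix w assume w: "w \<in> rcosets H"
  then have "w \<subseteq> carrier G" using rcosets_carrier by blast
  then show "inv g <# (g <# w) = w" "g <# (inv g <# w) = w"
    using g by (simp_all add: lcos_m_assoc lcos_mult_one)
qed (use g lcos_rcosets in auto)

lemma subgroup_rcoset: "H \<in> rcosets H"
  using subgroup_in_rcosets by (simp add: group_axioms)

end

lemma (in group) l_cosetE:
  assumes "a \<in> g <# w"
  obtains b where "b \<in> w" "a = g \<otimes> b"
  using assms by (auto simp: l_coset_def)

text \<open>
  The cosets of \<open>N\<close> are permuted transitively by left translation, which also permutes the cosets of
  \<open>K\<close>.  So each coset of \<open>N\<close> splits into the same number \<open>q\<close> of cosets of \<open>K\<close>.
\<close>

lemma (in group) rcosets_fibres:
  assumes K: "K \<lhd> G" and N: "N \<lhd> G" and KN: "K \<subseteq> N" and fin: "finite (rcosets K)"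
  obtains q where "q > 0" "\<And>u. u \<in> rcosets N \<Longrightarrow> card {w \<in> rcosets K. w \<subseteq> u} = q"
    "\<And>w. w \<in> rcosets K \<Longrightarrow> \<exists>u\<in>rcosets N. w \<subseteq> u"
    "\<And>w u v. w \<in> rcosets K \<Longrightarrow> u \<in> rcosets N \<Longrightarrow> v \<in> rcosets N \<Longrightarrow> w \<subseteq> u \<Longrightarrow> w \<subseteq> v \<Longrightarrow> u = v"
proof -
  interpret K: normal K G by fact
  interpret N: normal N G by fact
  define q where "q = card {w \<in> rcosets K. w \<subseteq> N}"
  have "K \<in> {w \<in> rcosets K. w \<subseteq> N}" using K.subgroup_rcoset KN by simp
  then have "q > 0" unfolding q_def using fin by (subst card_gt_0_iff) auto
  moreover have "card {w \<in> rcosets K. w \<subseteq> u} = q" if u: "u \<in> rcosets N" for u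
  proof -
    obtain a where a: "a \<in> carrier G" "u = a <# N" using u N.rcoset_eq_lcos_iff by auto
    have sub: "w \<subseteq> carrier G" if "w \<in> rcosets K" for w using that K.rcosets_carrier by blast
    have Nsub: "N \<subseteq> carrier G" by (rule N.subset)
    have inv_a: "inv a <# (a <# w) = w" "a <# (inv a <# w) = w" if "w \<subseteq> carrier G" for w
      using a that by (simp_all add: lcos_m_assoc lcos_mult_one)
    have mono: "g <# v \<subseteq> g <# w" if "v \<subseteq> w" for g v w using that by (auto simp: l_coset_def)
    have "bij_betw (\<lambda>w. a <# w) {w \<in> rcosets K. w \<subseteq> N} {w \<in> rcosets K. w \<subseteq> u}"
    proof (rule bij_betwI[where g = "\<lambda>w. inv a <# w"])
      show "(\<lambda>w. a <# w) \<in> {w \<in> rcosets K. w \<subseteq> N} \<rightarrow> {w \<in> rcosets K. w \<subseteq> u}"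
        using a K.lcos_rcosets mono by auto
      show "(\<lambda>w. inv a <# w) \<in> {w \<in> rcosets K. w \<subseteq> u} \<rightarrow> {w \<in> rcosets K. w \<subseteq> N}"
        using a K.lcos_rcosets mono[of _ u "inv a"] inv_a(1)[OF Nsub] by auto
    qed (use inv_a sub in auto)
    then show ?thesis unfolding q_def by (simp add: bij_betw_same_card)
  qed
  moreover have "\<exists>u\<in>rcosets N. w \<subseteq> u" if w: "w \<in> rcosets K" for w
  proof -
    obtain a where a: "a \<in> carrier G" "w = K #> a" using w by (auto simp: RCOSETS_def)
    then have "w \<subseteq> N #> a" using KN by (auto simp: r_coset_def)
    then show ?thesis using a rcosetsI[OF N.subset a(1)] by blast
  qed
  moreover have "u = v" if w: "w \<in> rcosets K" and u: "u \<in> rcosets N" and v: "v \<in> rcosets N"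
    and sub: "w \<subseteq> u" "w \<subseteq> v" for u v w
  proof -
    obtain a where a: "a \<in> carrier G" "w = K #> a" using w by (auto simp: RCOSETS_def)
    then have "a \<in> w" using rcos_self K.subgroup_axioms by simp
    then have "u \<inter> v \<noteq> {}" using sub by auto
    then show ?thesis using u v rcos_disjoint[OF N.subgroup_axioms]
      by (auto simp: pairwise_def disjnt_def)
  qed
  ultimately show thesis by (rule that)
qed

section \<open>Holes\<close>

text \<open>
  Since \<open>Per G N x \<subseteq> Per G K x\<close>, a hole of \<open>K\<close> lies in a hole of \<open>N\<close>, and such a hole contains at
  most \<open>q\<close> of them, while the index grows by the factor \<open>q\<close>.
\<close>

lemma (in group) hole_density_mono:
  assumes K: "K \<lhd> G" and N: "N \<lhd> G" and KN: "K \<subseteq> N"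
    and finK: "finite (rcosets K)" and finN: "finite (rcosets N)"
  shows "real (num_holes G K x) / real (card (rcosets K)) \<le> real (num_holes G N x) / real (card (rcosets N))"
proof -
  interpret K: normal K G by fact
  interpret N: normal N G by fact
  obtain q where q: "q > 0" "\<And>u. u \<in> rcosets N \<Longrightarrow> card {w \<in> rcosets K. w \<subseteq> u} = q"
    "\<And>w. w \<in> rcosets K \<Longrightarrow> \<exists>u\<in>rcosets N. w \<subseteq> u"
    "\<And>w u v. w \<in> rcosets K \<Longrightarrow> u \<in> rcosets N \<Longrightarrow> v \<in> rcosets N \<Longrightarrow> w \<subseteq> u \<Longrightarrow> w \<subseteq> v \<Longrightarrow> u = v"
    using rcosets_fibres[OF K N KN finK] by blast
  have union: "card (\<Union>u\<in>U. {w \<in> rcosets K. w \<subseteq> u}) = card U * q" if U: "U \<subseteq> rcosets N" for U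
  proof -
    have "card (\<Union>u\<in>U. {w \<in> rcosets K. w \<subseteq> u}) = (\<Sum>u\<in>U. card {w \<in> rcosets K. w \<subseteq> u})"
    proof (rule card_UN_disjoint)
      show "finite U" using U finN finite_subset by blast
      show "\<forall>u\<in>U. \<forall>v\<in>U. u \<noteq> v \<longrightarrow> {w \<in> rcosets K. w \<subseteq> u} \<inter> {w \<in> rcosets K. w \<subseteq> v} = {}"
        using q(4) U by blast
    qed (use finK in auto)
    also have "\<dots> = (\<Sum>u\<in>U. q)" using q(2) U by (intro sum.cong) auto
    finally show ?thesis by simp
  qed
  have "rcosets K = (\<Union>u\<in>rcosets N. {w \<in> rcosets K. w \<subseteq> u})" using q(3) by blast
  then have index: "card (rcosets K) = card (rcosets N) * q" using union[of "rcosets N"] by simp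
  let ?holes = "{u \<in> rcosets N. \<not> u \<subseteq> Per G N x}"
  have "Per G N x \<subseteq> Per G K x" using KN by (auto simp: Per_def)
  have "{w \<in> rcosets K. \<not> w \<subseteq> Per G K x} \<subseteq> (\<Union>u\<in>?holes. {w \<in> rcosets K. w \<subseteq> u})"
  proof
    fix w assume "w \<in> {w \<in> rcosets K. \<not> w \<subseteq> Per G K x}"
    then have w: "w \<in> rcosets K" "\<not> w \<subseteq> Per G K x" by auto
    obtain u where u: "u \<in> rcosets N" "w \<subseteq> u" using q(3)[OF w(1)] by auto
    moreover have "\<not> u \<subseteq> Per G N x"
      using u(2) w(2) \<open>Per G N x \<subseteq> Per G K x\<close> by (meson order_trans)
    ultimately show "w \<in> (\<Union>u\<in>?holes. {w \<in> rcosets K. w \<subseteq> u})" using w(1) by auto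
  qed
  then have "num_holes G K x \<le> card (\<Union>u\<in>?holes. {w \<in> rcosets K. w \<subseteq> u})"
    unfolding num_holes_def using finN finK by (intro card_mono) auto
  also have "\<dots> = num_holes G N x * q" unfolding num_holes_def by (rule union) auto
  finally have "num_holes G K x \<le> num_holes G N x * q" .
  then have "real (num_holes G K x) \<le> real (num_holes G N x) * real q"
    by (metis of_nat_le_iff of_nat_mult)
  then have "real (num_holes G K x) / (real (card (rcosets N)) * real q) \<le> 
    real (num_holes G N x) * real q / (real (card (rcosets N)) * real q)"
    by (intro divide_right_mono) auto
  then show ?thesis using q(1) by (simp add: index)
qed

lemma (in group) sum_ln_card_le_holes:
  assumes N: "N \<lhd> G" and fin: "finite (rcosets N)" and x: "x \<in> carrier G \<rightarrow> {1..k}" and k: "k \<ge> 1"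
  shows "(\<Sum>v\<in>rcosets N. ln (real (card (x ` v)))) \<le> real (num_holes G N x) * ln (real k)"
proof -
  interpret N: normal N G by fact
  have "(\<Sum>v\<in>rcosets N. ln (real (card (x ` v)))) \<le> (\<Sum>v\<in>rcosets N. if v \<subseteq> Per G N x then 0 else ln (real k))"
  proof (rule sum_mono)
    fix v assume v: "v \<in> rcosets N"
    then obtain a where a: "a \<in> carrier G" "v = N #> a" by (auto simp: RCOSETS_def)
    have av: "a \<in> v" using a rcos_self N.subgroup_axioms by simp
    show "ln (real (card (x ` v))) \<le> (if v \<subseteq> Per G N x then 0 else ln (real k))"
    proof (cases "v \<subseteq> Per G N x")
      case True
      have "x b = x a" if b: "b \<in> v" for b
      proof -
        obtain n where n: "n \<in> N" "b = n \<otimes> a" using b a by (auto simp: r_coset_def)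
        have "inv n \<in> N" using n by simp
        moreover have "a \<in> Per G N x" using True av by blast
        ultimately have "x (inv (inv n) \<otimes> a) = x a" unfolding Per_def by blast
        then show ?thesis using n N.mem_carrier by simp
      qed
      then have "x ` v = (\<lambda>_. x a) ` v" by (intro image_cong) auto
      then have "x ` v = {x a}" using av by (simp add: image_constant_conv split: if_splits)
      then show ?thesis using k by simp
    next
      case False
      have "x ` v \<subseteq> {1..k}" using x v N.rcosets_carrier by blast
      then have "card (x ` v) \<le> card {1..k}" by (intro card_mono) auto
      moreover have "finite (x ` v)"
        using \<open>x ` v \<subseteq> {1..k}\<close> by (rule finite_subset) simp
      then have "card (x ` v) > 0" using av by (subst card_gt_0_iff) auto
      ultimately show ?thesis using False by simp
    qed
  qed
  also have "\<dots> = (\<Sum>v\<in>{v\<in>rcosets N. \<not> v \<subseteq> Per G N x}. ln (real k))"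
    by (rule sum.mono_neutral_cong_right) (use fin in auto)
  also have "\<dots> = real (num_holes G N x) * ln (real k)" by (simp add: num_holes_def)
  finally show ?thesis .
qed

section \<open>The orbit closure\<close>

lemma (in group) shift_apply: "h \<in> carrier G \<Longrightarrow> shift G g y h = y (inv g \<otimes> h)"
  by (simp add: shift_def)

lemma (in group) shift_shift:
  assumes "s \<in> carrier G" "t \<in> carrier G"
  shows "shift G s (shift G t y) = shift G (s \<otimes> t) y"
  using assms by (auto simp: shift_def fun_eq_iff restrict_def inv_mult_group m_assoc)

lemma (in group) shift_image:
  assumes "g \<in> carrier G" "w \<subseteq> carrier G"
  shows "shift G g y ` w = y ` (inv g <# w)"
proof -
  have "inv g <# w = (\<lambda>h. inv g \<otimes> h) ` w" by (auto simp: l_coset_def)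
  then have "y ` (inv g <# w) = (\<lambda>h. y (inv g \<otimes> h)) ` w" by (simp add: image_image)
  also have "\<dots> = shift G g y ` w" using assms by (intro image_cong) (auto simp: shift_apply)
  finally show ?thesis by simp
qed

lemma topspace_full_shift: "topspace (full_shift G k) = carrier G \<rightarrow>\<^sub>E {1..k}"
  by (simp add: full_shift_def)

lemma (in group) shift_in_full_shift:
  "g \<in> carrier G \<Longrightarrow> y \<in> topspace (full_shift G k) \<Longrightarrow> shift G g y \<in> topspace (full_shift G k)"
  by (auto simp: topspace_full_shift shift_def PiE_iff)

text \<open>
  The sets of points with prescribed symbols at finitely many places form a base, which reduces all
  topological arguments about the orbit closure to finite patterns.
\<close>

lemma (in group) mem_orbit_closure_iff:
  assumes x: "x \<in> topspace (full_shift G k)"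
  shows "y \<in> topspace (orbit_closure G k x) \<longleftrightarrow> y \<in> topspace (full_shift G k) \<and>
           (\<forall>J. finite J \<and> J \<subseteq> carrier G \<longrightarrow> (\<exists>g\<in>carrier G. \<forall>j\<in>J. y j = shift G g x j))"
    (is "_ \<longleftrightarrow> _ \<and> ?approx")
proof -
  let ?Z = "full_shift G k" and ?O = "(\<lambda>g. shift G g x) ` carrier G"
  have "?approx" if y: "y \<in> topspace ?Z" and cl: "\<And>T. y \<in> T \<Longrightarrow> openin ?Z T \<Longrightarrow> \<exists>z. z \<in> ?O \<and> z \<in> T"
  proof (intro allI impI)
    fix J assume J: "finite J \<and> J \<subseteq> carrier G"
    have single: "openin ?Z {z \<in> topspace ?Z. z j \<in> {y j}}" if "j \<in> carrier G" for j
    proof (rule openin_continuous_map_preimage)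
      show "continuous_map ?Z (discrete_topology {1..k}) (\<lambda>z. z j)"
        unfolding full_shift_def using that by (rule continuous_map_product_projection)
      show "openin (discrete_topology {1..k}) {y j}" using y that by (auto simp: topspace_full_shift PiE_iff)
    qed
    have "openin ?Z {z \<in> topspace ?Z. \<forall>j\<in>J. z j = y j}"
    proof (cases "J = {}")
      case False
      then have "{z \<in> topspace ?Z. \<forall>j\<in>J. z j = y j} = (\<Inter>j\<in>J. {z \<in> topspace ?Z. z j \<in> {y j}})" by auto
      then show ?thesis using J False single by (auto intro!: openin_Inter)
    qed simp
    then have "\<exists>z. z \<in> ?O \<and> z \<in> {z \<in> topspace ?Z. \<forall>j\<in>J. z j = y j}"
      by (intro cl) (use y in auto)
    then obtain g where g: "g \<in> carrier G" "\<forall>j\<in>J. shift G g x j = y j" by auto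
    then have "\<forall>j\<in>J. y j = shift G g x j" by simp
    with g(1) show "\<exists>g\<in>carrier G. \<forall>j\<in>J. y j = shift G g x j" by (rule bexI[rotated])
  qed
  moreover have "\<exists>z. z \<in> ?O \<and> z \<in> T" if y: "y \<in> topspace ?Z" and a: ?approx and T: "y \<in> T" "openin ?Z T" for T
  proof -
    obtain U where U: "finite {i \<in> carrier G. U i \<noteq> topspace (discrete_topology {1..k})}"
      "y \<in> Pi\<^sub>E (carrier G) U" "Pi\<^sub>E (carrier G) U \<subseteq> T"
      using T unfolding full_shift_def openin_product_topology_alt by meson
    let ?J = "{i \<in> carrier G. U i \<noteq> topspace (discrete_topology {1..k})}"
    obtain g where g: "g \<in> carrier G" "\<And>j. j \<in> ?J \<Longrightarrow> y j = shift G g x j"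
      using a[rule_format, of ?J] U(1) by auto
    have s: "shift G g x \<in> carrier G \<rightarrow>\<^sub>E {1..k}"
      using shift_in_full_shift[OF g(1) x] by (simp add: topspace_full_shift)
    have "shift G g x \<in> Pi\<^sub>E (carrier G) U"
    proof (rule PiE_I)
      fix i assume i: "i \<in> carrier G"
      show "shift G g x i \<in> U i"
        using g(2)[of i] U(2) i s by (cases "i \<in> ?J") (auto simp: PiE_iff)
    qed (use s in \<open>auto simp: PiE_iff extensional_def\<close>)
    then show ?thesis using U(3) g(1) by blast
  qed
  ultimately show ?thesis
    unfolding orbit_closure_def topspace_subtopology by (auto simp: in_closure_of)
qed

lemma (in group) shift_in_orbit_closure:
  assumes x: "x \<in> topspace (full_shift G k)" and s: "s \<in> carrier G" and y: "y \<in> topspace (orbit_closure G k x)"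
  shows "shift G s y \<in> topspace (orbit_closure G k x)"
  unfolding mem_orbit_closure_iff[OF x]
proof (intro conjI allI impI)
  have y': "y \<in> topspace (full_shift G k)"
    "\<And>J. finite J \<Longrightarrow> J \<subseteq> carrier G \<Longrightarrow> \<exists>g\<in>carrier G. \<forall>j\<in>J. y j = shift G g x j"
    using y mem_orbit_closure_iff[OF x] by auto
  show "shift G s y \<in> topspace (full_shift G k)" using shift_in_full_shift[OF s y'(1)] .
  fix J assume J: "finite J \<and> J \<subseteq> carrier G"
  then obtain g where g: "g \<in> carrier G" "\<forall>j\<in>(\<lambda>j. inv s \<otimes> j) ` J. y j = shift G g x j"
    using y'(2)[of "(\<lambda>j. inv s \<otimes> j) ` J"] s by auto
  have "shift G s y j = shift G (s \<otimes> g) x j" if "j \<in> J" for j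
  proof -
    have j: "j \<in> carrier G" using that J by auto
    then have "shift G s y j = y (inv s \<otimes> j)" by (rule shift_apply)
    also have "\<dots> = shift G g x (inv s \<otimes> j)" using g(2) that by blast
    also have "\<dots> = shift G s (shift G g x) j" using j by (simp add: shift_apply)
    finally show ?thesis using s g(1) by (simp add: shift_shift)
  qed
  then show "\<exists>g\<in>carrier G. \<forall>j\<in>J. shift G s y j = shift G g x j" using s g(1) by blast
qed

lemma (in group) orbit_in_orbit_closure:
  assumes x: "x \<in> topspace (full_shift G k)" and g: "g \<in> carrier G"
  shows "shift G g x \<in> topspace (orbit_closure G k x)"
  using shift_in_full_shift[OF g x] g by (auto simp: mem_orbit_closure_iff[OF x])

lemma compact_space_orbit_closure: "compact_space (orbit_closure G k x)"
proof -
  have "compact_space (full_shift G k)"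
    by (simp add: full_shift_def compact_space_product_topology compact_space_discrete_topology)
  then show ?thesis unfolding orbit_closure_def
    by (intro compact_space_subtopology closedin_compact_space closedin_closure_of)
qed

lemma (in group) continuous_map_shift:
  assumes x: "x \<in> topspace (full_shift G k)" and s: "s \<in> carrier G"
  shows "continuous_map (orbit_closure G k x) (orbit_closure G k x) (shift G s)"
proof -
  have "continuous_map (orbit_closure G k x) (full_shift G k) (shift G s)"
    unfolding full_shift_def
  proof (subst continuous_map_componentwise, intro conjI ballI)
    show "shift G s ` topspace (orbit_closure G k x) \<subseteq> extensional (carrier G)"
      by (auto simp: shift_def)
    fix h assume h: "h \<in> carrier G"
    have "continuous_map (full_shift G k) (discrete_topology {1..k}) (\<lambda>y. y (inv s \<otimes> h))"
      unfolding full_shift_def using s h by (intro continuous_map_product_projection) auto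
    then have "continuous_map (orbit_closure G k x) (discrete_topology {1..k}) (\<lambda>y. y (inv s \<otimes> h))"
      unfolding orbit_closure_def by (rule continuous_map_from_subtopology)
    then show "continuous_map (orbit_closure G k x) (discrete_topology {1..k}) (\<lambda>y. shift G s y h)"
      using h by (simp add: shift_apply)
  qed
  moreover have "shift G s ` topspace (orbit_closure G k x) \<subseteq> topspace (orbit_closure G k x)"
    using shift_in_orbit_closure[OF x s] by auto
  ultimately have "continuous_map (orbit_closure G k x) (subtopology (full_shift G k) (topspace (orbit_closure G k x))) (shift G s)"
    by (simp add: continuous_map_in_subtopology image_subset_iff_funcset)
  moreover have "subtopology (full_shift G k) (topspace (orbit_closure G k x)) = orbit_closure G k x"
    unfolding orbit_closure_def by (metis subtopology_restrict topspace_subtopology)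
  ultimately show ?thesis by simp
qed

section \<open>Toeplitz elements\<close>

locale toeplitz_element = group G for G (structure) +
  fixes k :: nat and H :: "nat \<Rightarrow> 'a set" and x :: "'a \<Rightarrow> nat"
  assumes H_normal: "\<And>n. H n \<lhd> G"
    and H_finite_index: "\<And>n. finite (rcosets H n)"
    and H_decseq: "decseq H"
    and x_full_shift: "x \<in> topspace (full_shift G k)"
    and x_toeplitz: "toeplitz G H x"
begin

abbreviation "X \<equiv> orbit_closure G k x"

lemma finite_subset_Per:
  assumes "finite E" "E \<subseteq> carrier G"
  shows "\<exists>l. E \<subseteq> Per G (H l) x"
  using assms
proof (induction rule: finite_induct)
  case (insert e E)
  have mono: "Per G (H i) x \<subseteq> Per G (H j) x" if "i \<le> j" for i j
    using H_decseq that by (auto simp: Per_def decseq_def)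
  obtain l where "E \<subseteq> Per G (H l) x" using insert by auto
  moreover obtain j where "e \<in> Per G (H j) x" using insert x_toeplitz by (auto simp: toeplitz_def)
  ultimately have "insert e E \<subseteq> Per G (H (max l j)) x"
    using mono[of l "max l j"] mono[of j "max l j"] by auto
  then show ?case by blast
qed auto

lemma orbit_approximation:
  assumes "y \<in> topspace X" "finite J" "J \<subseteq> carrier G"
  obtains g where "g \<in> carrier G" "\<And>j. j \<in> J \<Longrightarrow> y j = shift G g x j"
  using assms that unfolding mem_orbit_closure_iff[OF x_full_shift] by meson

text \<open>
  A finite set \<open>E\<close> lies in \<open>Per G (H l) x\<close> for some \<open>l\<close>, so the pattern of \<open>x\<close> on \<open>E\<close> recurs in the
  translate of \<open>x\<close> by \<open>g\<close> at all points of the coset \<open>g <# H l\<close>.  That coset meets every transversal \<open>R\<close>, and the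
  property passes to the closure since it concerns only the finite set of products.
\<close>

lemma uniform_recurrence:
  assumes E: "finite E" "E \<subseteq> carrier G"
  obtains R where "finite R" "R \<subseteq> carrier G" "\<And>y. y \<in> topspace X \<Longrightarrow> \<exists>t\<in>R. \<forall>e\<in>E. y (t \<otimes> e) = x e"
proof -
  obtain l where l: "E \<subseteq> Per G (H l) x" using finite_subset_Per[OF E] by auto
  interpret L: normal "H l" G by (rule H_normal)
  have "\<forall>w\<in>rcosets H l. \<exists>a\<in>carrier G. w = a <# H l" using L.rcoset_eq_lcos_iff by blast
  then obtain r where r: "\<And>w. w \<in> rcosets H l \<Longrightarrow> r w \<in> carrier G \<and> w = r w <# H l" by metis
  define R where "R = r ` (rcosets H l)"
  have R: "finite R" "R \<subseteq> carrier G" using H_finite_index r by (auto simp: R_def)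
  have "\<exists>t\<in>R. \<forall>e\<in>E. y (t \<otimes> e) = x e" if y: "y \<in> topspace X" for y
  proof -
    let ?J = "(\<lambda>(t, e). t \<otimes> e) ` (R \<times> E)"
    have J: "finite ?J" "?J \<subseteq> carrier G" using R E by auto
    obtain g where g: "g \<in> carrier G" "\<And>j. j \<in> ?J \<Longrightarrow> y j = shift G g x j"
      using orbit_approximation[OF y J] by metis
    have w: "g <# H l \<in> rcosets H l" using g(1) L.rcoset_eq_lcos_iff by blast
    define t where "t = r (g <# H l)"
    have t: "t \<in> R" "t \<in> carrier G" "g <# H l = t <# H l" using w r by (auto simp: t_def R_def)
    have "t \<in> t <# H l" using t(2) L.one_closed by (force simp: l_coset_def)
    then have "t \<in> g <# H l" using t(3) by simp
    then obtain h where h: "h \<in> H l" "t = g \<otimes> h" by (rule l_cosetE)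
    have hG: "h \<in> carrier G" using h L.subset by auto
    have "y (t \<otimes> e) = x e" if e: "e \<in> E" for e
    proof -
      have eG: "e \<in> carrier G" using e E by auto
      have "y (t \<otimes> e) = shift G g x (t \<otimes> e)" using t(1) e by (intro g(2)) auto
      also have "\<dots> = x (inv g \<otimes> (g \<otimes> h \<otimes> e))" using h t(2) eG by (simp add: shift_apply)
      also have "inv g \<otimes> (g \<otimes> h \<otimes> e) = h \<otimes> e" using g(1) hG eG by (simp add: m_assoc[symmetric])
      also have "x (h \<otimes> e) = x (inv (inv h) \<otimes> e)" using hG by simp
      also have "\<dots> = x e"
        using l e h L.m_inv_closed unfolding Per_def by blast
      finally show ?thesis .
    qed
    then show ?thesis using t(1) by blast
  qed
  then show thesis using that R by blast
qed

lemma orbit_closure_values: "y \<in> topspace X \<Longrightarrow> a \<in> carrier G \<Longrightarrow> y a \<in> {1..k}"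
  by (auto simp: mem_orbit_closure_iff[OF x_full_shift] topspace_full_shift PiE_iff)

lemma x_in_orbit_closure: "x \<in> topspace X"
  unfolding mem_orbit_closure_iff[OF x_full_shift]
proof (intro conjI allI impI)
  fix J assume "finite J \<and> J \<subseteq> carrier G"
  then have "\<forall>j\<in>J. x j = shift G \<one> x j" by (auto simp: shift_apply)
  then show "\<exists>g\<in>carrier G. \<forall>j\<in>J. x j = shift G g x j" by blast
qed (rule x_full_shift)

lemma rcosets_subset: "w \<in> rcosets H m \<Longrightarrow> w \<subseteq> carrier G"
  using normal.axioms(1)[OF H_normal] subgroup.rcosets_carrier is_group by blast

lemma finite_values:
  assumes "y \<in> topspace X" "w \<subseteq> carrier G"
  shows "finite (y ` w)"
proof -
  have "y ` w \<subseteq> {1..k}" using assms orbit_closure_values by blast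
  then show ?thesis by (rule finite_subset) simp
qed

lemma sum_values_shift:
  assumes g: "g \<in> carrier G"
  shows "(\<Sum>w\<in>rcosets H m. f (shift G g y ` w)) = (\<Sum>w\<in>rcosets H m. f (y ` w))"
proof -
  interpret N: normal "H m" G by (rule H_normal)
  have "(\<Sum>w\<in>rcosets H m. f (shift G g y ` w)) = (\<Sum>w\<in>rcosets H m. f (y ` (inv g <# w)))"
    using g rcosets_subset by (intro sum.cong) (simp_all add: shift_image)
  then show ?thesis using g N.sum_lcos[of "inv g" "\<lambda>w. f (y ` w)"] by simp
qed

lemma finite_witness:
  assumes y: "y \<in> topspace X"
  obtains J where "finite J" "J \<subseteq> carrier G" "\<And>w. w \<in> rcosets H m \<Longrightarrow> y ` w = y ` (J \<inter> w)"
proof -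
  have "\<exists>C\<subseteq>w. finite C \<and> y ` w = y ` C" if "w \<in> rcosets H m" for w
    using finite_subset_image[of "y ` w" y w] finite_values[OF y rcosets_subset[OF that]] by auto
  then obtain C where C: "\<And>w. w \<in> rcosets H m \<Longrightarrow> C w \<subseteq> w \<and> finite (C w) \<and> y ` w = y ` C w"
    by metis
  define J where "J = (\<Union>w\<in>rcosets H m. C w)"
  have "finite J" using C H_finite_index by (auto simp: J_def)
  moreover have "J \<subseteq> carrier G" using C rcosets_subset unfolding J_def by blast
  moreover have "y ` w = y ` (J \<inter> w)" if w: "w \<in> rcosets H m" for w
  proof
    have "C w \<subseteq> J \<inter> w" using C w by (auto simp: J_def)
    then have "y ` C w \<subseteq> y ` (J \<inter> w)" by (rule image_mono)
    then show "y ` w \<subseteq> y ` (J \<inter> w)" using C[OF w] by simp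
  qed auto
  ultimately show thesis by (rule that)
qed

text \<open>
  All values of \<open>y\<close> on the finitely many cosets occur in a finite window, on which \<open>y\<close> agrees with some
  translate of \<open>x\<close>.
\<close>

lemma values_subset:
  assumes y: "y \<in> topspace X"
  obtains g where "g \<in> carrier G" "\<And>w. w \<in> rcosets H m \<Longrightarrow> y ` w \<subseteq> shift G g x ` w"
proof -
  obtain J where J: "finite J" "J \<subseteq> carrier G" "\<And>w. w \<in> rcosets H m \<Longrightarrow> y ` w = y ` (J \<inter> w)"
    using finite_witness[OF y, of m] by metis
  obtain g where g: "g \<in> carrier G" "\<And>j. j \<in> J \<Longrightarrow> y j = shift G g x j"
    using orbit_approximation[OF y J(1,2)] by metis
  have "y ` w \<subseteq> shift G g x ` w" if w: "w \<in> rcosets H m" for w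
  proof -
    have "y ` w = shift G g x ` (J \<inter> w)" unfolding J(3)[OF w] using g(2) by (intro image_cong) auto
    then show ?thesis by auto
  qed
  then show thesis using that g(1) by blast
qed

text \<open>
  Recurrence of a window that displays all values of \<open>x\<close> shows that \<open>y\<close> has, inside the window \<open>J\<close>, at
  least the values of \<open>x\<close>, coset by coset after a translation; by \<open>values_subset\<close> it has on the
  whole cosets at most the values of \<open>x\<close>, after another translation.  The two translations need not be
  the same, but the total number of values over all cosets is insensitive to them.  So the totals are
  equal, and then all inclusions are equalities.
\<close>

proposition uniform_witness:
  obtains J where "finite J" "J \<subseteq> carrier G"
    "\<And>y w. y \<in> topspace X \<Longrightarrow> w \<in> rcosets H m \<Longrightarrow> y ` w = y ` (J \<inter> w)"
    "\<And>y. y \<in> topspace X \<Longrightarrow>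
       (\<Sum>w\<in>rcosets H m. ln (real (card (y ` w)))) = (\<Sum>w\<in>rcosets H m. ln (real (card (x ` w))))"
proof -
  interpret N: normal "H m" G by (rule H_normal)
  obtain E where E: "finite E" "E \<subseteq> carrier G" "\<And>w. w \<in> rcosets H m \<Longrightarrow> x ` w = x ` (E \<inter> w)"
    using finite_witness[OF x_in_orbit_closure, of m] by metis
  obtain R where R: "finite R" "R \<subseteq> carrier G" "\<And>y. y \<in> topspace X \<Longrightarrow> \<exists>t\<in>R. \<forall>e\<in>E. y (t \<otimes> e) = x e"
    using uniform_recurrence[OF E(1,2)] by metis
  define J where "J = (\<lambda>(t, e). t \<otimes> e) ` (R \<times> E)"
  have J: "finite J" "J \<subseteq> carrier G" using R E by (auto simp: J_def)
  have main: "(\<forall>w\<in>rcosets H m. y ` w = y ` (J \<inter> w)) \<and>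
     (\<Sum>w\<in>rcosets H m. ln (real (card (y ` w)))) = (\<Sum>w\<in>rcosets H m. ln (real (card (x ` w))))"
    if y: "y \<in> topspace X" for y
  proof -
    have fin: "finite (y ` w)" "finite (y ` (J \<inter> w))" if "w \<in> rcosets H m" for w
      using finite_values[OF y rcosets_subset[OF that]] by (auto elim: rev_finite_subset)
    have upper: "card (y ` (J \<inter> w)) \<le> card (y ` w)" if "w \<in> rcosets H m" for w
      using fin[OF that] by (intro card_mono) auto
    obtain t where t: "t \<in> R" "\<forall>e\<in>E. y (t \<otimes> e) = x e" using R(3)[OF y] by auto
    have tG: "t \<in> carrier G" using t R by auto
    obtain g where g: "g \<in> carrier G" "\<And>w. w \<in> rcosets H m \<Longrightarrow> y ` w \<subseteq> shift G g x ` w"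
      using values_subset[OF y, of m] by metis
    have gX: "shift G g x \<in> topspace X" using orbit_in_orbit_closure[OF x_full_shift g(1)] .
    have fing: "finite (shift G g x ` w)" if "w \<in> rcosets H m" for w
      using finite_values[OF gX rcosets_subset[OF that]] .
    have card_g: "card (y ` w) \<le> card (shift G g x ` w)" if "w \<in> rcosets H m" for w
      using g(2)[OF that] fing[OF that] by (intro card_mono)
    have lower: "card (x ` w) \<le> card (y ` (J \<inter> (t <# w)))" if w: "w \<in> rcosets H m" for w
    proof -
      have "x ` w \<subseteq> y ` (J \<inter> (t <# w))"
      proof
        fix b assume "b \<in> x ` w"
        then obtain e where e: "e \<in> E" "e \<in> w" "b = x e" using E(3)[OF w] by auto
        then have "t \<otimes> e \<in> J \<inter> (t <# w)" "y (t \<otimes> e) = b" using t by (auto simp: J_def l_coset_def)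
        then show "b \<in> y ` (J \<inter> (t <# w))" by blast
      qed
      then show ?thesis using fin(2)[OF N.lcos_rcosets[OF tG w]] by (intro card_mono)
    qed
    have "(\<Sum>w\<in>rcosets H m. card (x ` w)) \<le> (\<Sum>w\<in>rcosets H m. card (y ` (J \<inter> (t <# w))))"
      using lower by (rule sum_mono)
    also have "\<dots> = (\<Sum>w\<in>rcosets H m. card (y ` (J \<inter> w)))" using tG by (rule N.sum_lcos)
    finally have 1: "(\<Sum>w\<in>rcosets H m. card (x ` w)) \<le> (\<Sum>w\<in>rcosets H m. card (y ` (J \<inter> w)))" .
    have 2: "(\<Sum>w\<in>rcosets H m. card (y ` (J \<inter> w))) \<le> (\<Sum>w\<in>rcosets H m. card (y ` w))"
      using upper by (rule sum_mono)
    have 3: "(\<Sum>w\<in>rcosets H m. card (y ` w)) \<le> (\<Sum>w\<in>rcosets H m. card (shift G g x ` w))"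
      using card_g by (rule sum_mono)
    have 4: "(\<Sum>w\<in>rcosets H m. card (shift G g x ` w)) = (\<Sum>w\<in>rcosets H m. card (x ` w))"
      using g(1) by (rule sum_values_shift)
    have eqJ: "card (y ` (J \<inter> w)) = card (y ` w)" if "w \<in> rcosets H m" for w
      by (rule sum_mono_inv[OF _ upper that H_finite_index]) (use 1 2 3 4 in linarith)
    have eqg: "card (y ` w) = card (shift G g x ` w)" if "w \<in> rcosets H m" for w
      by (rule sum_mono_inv[OF _ card_g that H_finite_index]) (use 1 2 3 4 in linarith)
    have "y ` w = y ` (J \<inter> w)" if "w \<in> rcosets H m" for w
      using card_subset_eq[OF fin(1)[OF that] image_mono[OF Int_lower2] eqJ[OF that]] by simp
    moreover have "(\<Sum>w\<in>rcosets H m. ln (real (card (y ` w)))) = (\<Sum>w\<in>rcosets H m. ln (real (card (x ` w))))"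
      using eqg sum_values_shift[OF g(1), of "\<lambda>A. ln (real (card A))"] by simp
    ultimately show ?thesis by blast
  qed
  show thesis by (rule that[OF J]) (use main in blast)+
qed

end

section \<open>Coordinates and the pseudometric\<close>

locale toeplitz_metric = toeplitz_element +
  fixes d :: "('a \<Rightarrow> nat) \<Rightarrow> ('a \<Rightarrow> nat) \<Rightarrow> real"
  assumes d_cont: "continuous_pseudometric X d"
    and d_gen: "dynamically_generating G X (shift G) d"
begin

abbreviation "XX \<equiv> prod_topology X X"

lemma compact_XX: "compact_space XX"
  by (simp add: compact_space_prod_topology compact_space_orbit_closure)

lemma coordinates_differ_clopen:
  assumes "g \<in> carrier G"
  shows "openin XX {p \<in> topspace XX. fst p g \<noteq> snd p g}" "closedin XX {p \<in> topspace XX. fst p g \<noteq> snd p g}"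
proof -
  let ?D = "discrete_topology {1..k}"
  have c: "continuous_map X ?D (\<lambda>y. y g)"
    unfolding orbit_closure_def full_shift_def
    using assms by (intro continuous_map_from_subtopology continuous_map_product_projection)
  have "continuous_map XX (prod_topology ?D ?D) (\<lambda>p. (fst p g, snd p g))"
    using continuous_map_compose[OF continuous_map_fst[of X X] c] continuous_map_compose[OF continuous_map_snd[of X X] c]
    by (simp add: continuous_map_pairwise o_def)
  then have f: "continuous_map XX (discrete_topology ({1..k} \<times> {1..k})) (\<lambda>p. (fst p g, snd p g))"
    by (simp add: prod_topology_discrete_topology)
  let ?S = "{q \<in> {1..k} \<times> {1..k}. fst q \<noteq> snd q}"
  have eq: "{p \<in> topspace XX. fst p g \<noteq> snd p g} = {p \<in> topspace XX. (fst p g, snd p g) \<in> ?S}"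
    using orbit_closure_values assms by fastforce
  show "openin XX {p \<in> topspace XX. fst p g \<noteq> snd p g}"
    unfolding eq by (rule openin_continuous_map_preimage[OF f]) auto
  show "closedin XX {p \<in> topspace XX. fst p g \<noteq> snd p g}"
    unfolding eq by (rule closedin_continuous_map_preimage[OF f]) auto
qed

text \<open>
  The compact set of pairs at distance at least \<open>\<epsilon>\<close> is covered by the open sets of pairs that differ in
  one given coordinate.
\<close>

lemma close_if_coordinates_agree:
  assumes \<epsilon>: "\<epsilon> > 0"
  obtains E where "finite E" "E \<subseteq> carrier G"
    "\<And>y z. y \<in> topspace X \<Longrightarrow> z \<in> topspace X \<Longrightarrow> \<forall>g\<in>E. y g = z g \<Longrightarrow> d y z \<le> \<epsilon>"
proof -
  define U where "U g = {p \<in> topspace XX. fst p g \<noteq> snd p g}" for g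
  let ?C = "{p \<in> topspace XX. (\<lambda>(y, z). d y z) p \<in> {\<epsilon>..}}"
  have "closedin XX ?C"
    by (rule closedin_continuous_map_preimage[where Y = euclideanreal])
       (use d_cont in \<open>auto simp: continuous_pseudometric_def\<close>)
  then have "compactin XX ?C" by (rule closedin_compact_space[OF compact_XX])
  moreover have "\<And>S. S \<in> U ` carrier G \<Longrightarrow> openin XX S"
    unfolding U_def using coordinates_differ_clopen(1) by auto
  moreover have "?C \<subseteq> \<Union>(U ` carrier G)"
  proof
    fix p assume p: "p \<in> ?C"
    obtain y z where yz: "p = (y, z)" by (cases p)
    have yX: "y \<in> topspace X" "z \<in> topspace X" "d y z \<ge> \<epsilon>" using p yz by auto
    then have "y \<noteq> z" using d_cont \<epsilon> by (auto simp: continuous_pseudometric_def)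
    moreover have "y \<in> extensional (carrier G)" "z \<in> extensional (carrier G)"
      using yX unfolding mem_orbit_closure_iff[OF x_full_shift] topspace_full_shift by (auto simp: PiE_iff)
    ultimately obtain g where "g \<in> carrier G" "y g \<noteq> z g" by (meson extensionalityI)
    then show "p \<in> \<Union>(U ` carrier G)" using p yz by (auto simp: U_def)
  qed
  ultimately have "\<exists>\<F>. finite \<F> \<and> \<F> \<subseteq> U ` carrier G \<and> ?C \<subseteq> \<Union>\<F>"
    by (rule compactinD)
  then obtain \<F> where \<F>: "finite \<F>" "\<F> \<subseteq> U ` carrier G" "?C \<subseteq> \<Union>\<F>" by auto
  obtain E where E: "E \<subseteq> carrier G" "finite E" "\<F> = U ` E"
    using finite_subset_image[OF \<F>(1,2)] by auto
  have "d y z \<le> \<epsilon>" if "y \<in> topspace X" "z \<in> topspace X" "\<forall>g\<in>E. y g = z g" for y z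
  proof (rule ccontr)
    assume "\<not> d y z \<le> \<epsilon>"
    then have "(y, z) \<in> ?C" using that by auto
    then have "(y, z) \<in> \<Union>(U ` E)" using \<F>(3) E(3) by blast
    then show False using that(3) by (auto simp: U_def)
  qed
  then show thesis using that E by blast
qed

text \<open>
  Conversely, pairs that differ somewhere in \<open>J\<close> form a compact set, which is covered by the open sets of pairs
  that some shift moves apart by more than \<open>1 / Suc j\<close>, because \<open>d\<close> is dynamically generating.
\<close>

lemma apart_if_coordinates_differ:
  assumes J: "finite J" "J \<subseteq> carrier G"
  obtains P \<kappa> where "finite P" "P \<subseteq> carrier G" "\<kappa> > 0"
    "\<And>y z g. y \<in> topspace X \<Longrightarrow> z \<in> topspace X \<Longrightarrow> g \<in> J \<Longrightarrow> y g \<noteq> z g \<Longrightarrow>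
       \<exists>p\<in>P. d (shift G p y) (shift G p z) > \<kappa>"
proof -
  let ?dist = "\<lambda>s p. d (shift G s (fst p)) (shift G s (snd p))"
  define U where "U q = {p \<in> topspace XX. ?dist (fst q) p \<in> {1 / real (Suc (snd q))<..}}" for q :: "'a \<times> nat"
  let ?C = "\<Union>g\<in>J. {p \<in> topspace XX. fst p g \<noteq> snd p g}"
  have "closedin XX ?C" using J coordinates_differ_clopen(2) by (intro closedin_Union) auto
  then have "compactin XX ?C" by (rule closedin_compact_space[OF compact_XX])
  moreover have "\<And>S. S \<in> U ` (carrier G \<times> UNIV) \<Longrightarrow> openin XX S"
  proof -
    fix S assume "S \<in> U ` (carrier G \<times> UNIV)"
    then obtain q where q: "S = U q" "fst q \<in> carrier G" by auto
    have sh: "continuous_map X X (shift G (fst q))" using continuous_map_shift[OF x_full_shift q(2)] .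
    have "continuous_map XX XX (\<lambda>p. (shift G (fst q) (fst p), shift G (fst q) (snd p)))"
      using continuous_map_compose[OF continuous_map_fst[of X X] sh] continuous_map_compose[OF continuous_map_snd[of X X] sh]
      by (simp add: continuous_map_pairwise o_def)
    moreover have "continuous_map XX euclideanreal (\<lambda>p. d (fst p) (snd p))"
      using d_cont by (simp add: continuous_pseudometric_def case_prod_unfold)
    ultimately have "continuous_map XX euclideanreal
        ((\<lambda>p. d (fst p) (snd p)) \<circ> (\<lambda>p. (shift G (fst q) (fst p), shift G (fst q) (snd p))))"
      by (rule continuous_map_compose)
    then have "continuous_map XX euclideanreal (?dist (fst q))" by (simp add: o_def)
    then show "openin XX S" unfolding q(1) U_def by (rule openin_continuous_map_preimage) auto
  qed
  moreover have "?C \<subseteq> \<Union>(U ` (carrier G \<times> UNIV))"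
  proof
    fix p assume "p \<in> ?C"
    then obtain g where p: "p \<in> topspace XX" "fst p g \<noteq> snd p g" by auto
    then have "fst p \<noteq> snd p" by auto
    then obtain s where s: "s \<in> carrier G" "?dist s p > 0"
      using d_gen p(1) unfolding dynamically_generating_def topspace_prod_topology mem_Times_iff by blast
    obtain j where "1 / real (Suc j) < ?dist s p" using nat_approx_posE[OF s(2)] by metis
    then have "p \<in> U (s, j)" using p by (auto simp: U_def)
    then show "p \<in> \<Union>(U ` (carrier G \<times> UNIV))" using s(1) by blast
  qed
  ultimately have "\<exists>\<F>. finite \<F> \<and> \<F> \<subseteq> U ` (carrier G \<times> UNIV) \<and> ?C \<subseteq> \<Union>\<F>"
    by (rule compactinD)
  then obtain \<F> where \<F>: "finite \<F>" "\<F> \<subseteq> U ` (carrier G \<times> UNIV)" "?C \<subseteq> \<Union>\<F>" by auto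
  obtain Q where Q: "Q \<subseteq> carrier G \<times> UNIV" "finite Q" "\<F> = U ` Q"
    using finite_subset_image[OF \<F>(1,2)] by auto
  define N where "N = Max (insert 0 (snd ` Q))"
  have N: "j \<le> N" if "(s, j) \<in> Q" for s j
    unfolding N_def using Q(2) that by (intro Max_ge) force+
  show thesis
  proof (rule that)
    show "finite (fst ` Q)" "fst ` Q \<subseteq> carrier G" "1 / real (Suc N) > 0" using Q by auto
    fix y z g assume yz: "y \<in> topspace X" "z \<in> topspace X" "g \<in> J" "y g \<noteq> z g"
    then have "(y, z) \<in> ?C" by auto
    then have "(y, z) \<in> \<Union>(U ` Q)" using \<F>(3) Q(3) by blast
    then obtain s j where sj: "(s, j) \<in> Q" "1 / real (Suc j) < ?dist s (y, z)" by (auto simp: U_def)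
    have "1 / real (Suc N) \<le> 1 / real (Suc j)" using N[OF sj(1)] by (simp add: frac_le)
    then have "1 / real (Suc N) < d (shift G s y) (shift G s z)" using sj(2) by simp
    then show "\<exists>p\<in>fst ` Q. 1 / real (Suc N) < d (shift G p y) (shift G p z)" using sj(1) by force
  qed
qed

end

section \<open>Sofic approximations\<close>

text \<open>
  The conditions on a sofic approximation are limits of proportions; this is the form in which they
  are used.  Nonemptiness comes for free as the proportion is \<open>0\<close> on the empty set.
\<close>

lemma few_exceptions:
  fixes V :: "nat \<Rightarrow> 'v set"
  assumes lim: "(\<lambda>n. real (card {v \<in> V n. P n v}) / real (card (V n))) \<longlonglongrightarrow> 1"
    and fin: "\<And>n. finite (V n)" and \<theta>: "\<theta> > 0"
  shows "\<forall>\<^sub>F n in sequentially. V n \<noteq> {} \<and> real (card {v \<in> V n. \<not> P n v}) \<le> \<theta> * real (card (V n))"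
proof -
  have "\<forall>\<^sub>F n in sequentially. real (card {v \<in> V n. P n v}) / real (card (V n)) > max 0 (1 - \<theta>)"
    using lim \<theta> by (intro order_tendstoD(1)) auto
  then show ?thesis
  proof (rule eventually_mono)
    fix n assume n: "real (card {v \<in> V n. P n v}) / real (card (V n)) > max 0 (1 - \<theta>)"
    then have pos: "real (card (V n)) > 0" by (cases "card (V n) = 0") auto
    then have "real (card {v \<in> V n. P n v}) \<ge> (1 - \<theta>) * real (card (V n))"
      using n by (simp add: field_simps)
    moreover have "card (V n) = card {v \<in> V n. P n v} + card {v \<in> V n. \<not> P n v}"
    proof -
      have "V n = {v \<in> V n. P n v} \<union> {v \<in> V n. \<not> P n v}" by auto
      then have "card (V n) = card ({v \<in> V n. P n v} \<union> {v \<in> V n. \<not> P n v})" by simp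
      also have "\<dots> = card {v \<in> V n. P n v} + card {v \<in> V n. \<not> P n v}"
        using fin[of n] by (intro card_Un_disjoint) auto
      finally show ?thesis .
    qed
    ultimately show "V n \<noteq> {} \<and> real (card {v \<in> V n. \<not> P n v}) \<le> \<theta> * real (card (V n))"
      using pos by (auto simp: algebra_simps)
  qed
qed

lemma sofic_approximation_bij:
  assumes "sofic_approximation G V \<sigma>" "s \<in> carrier G"
  shows "bij_betw (\<sigma> n s) (V n) (V n)"
proof -
  have "\<sigma> n \<in> carrier G \<rightarrow> carrier (BijGroup (V n))" using assms(1) by (simp add: sofic_approximation_def)
  then have "\<sigma> n s \<in> carrier (BijGroup (V n))" using assms(2) by (rule funcset_mem)
  then show ?thesis by (simp add: BijGroup_def Bij_def)
qed

lemma d2_markov: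
  assumes V: "finite V" and d2: "d2 V d \<phi> \<psi> \<le> \<delta>" and c: "c > 0"
  shows "real (card {v\<in>V. d (\<phi> v) (\<psi> v) > c}) * c\<^sup>2 \<le> \<delta>\<^sup>2 * real (card V)"
proof (cases "V = {}")
  case False
  then have pos: "real (card V) > 0" using V by (simp add: card_gt_0_iff)
  let ?S = "\<Sum>v\<in>V. (d (\<phi> v) (\<psi> v))\<^sup>2"
  have "0 \<le> ?S / real (card V)" by (intro divide_nonneg_nonneg sum_nonneg) auto
  then have "?S / real (card V) = (sqrt (?S / real (card V)))\<^sup>2" by simp
  also have "\<dots> \<le> \<delta>\<^sup>2"
    using d2 \<open>0 \<le> ?S / real (card V)\<close> unfolding d2_def by (intro power_mono) auto
  finally have S: "?S \<le> \<delta>\<^sup>2 * real (card V)" using pos by (simp add: field_simps)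
  have "real (card {v\<in>V. d (\<phi> v) (\<psi> v) > c}) * c\<^sup>2 = (\<Sum>v\<in>{v\<in>V. d (\<phi> v) (\<psi> v) > c}. c\<^sup>2)" by simp
  also have "\<dots> \<le> (\<Sum>v\<in>{v\<in>V. d (\<phi> v) (\<psi> v) > c}. (d (\<phi> v) (\<psi> v))\<^sup>2)"
    using c by (intro sum_mono power_mono) auto
  also have "\<dots> \<le> ?S" using V by (intro sum_mono2) auto
  finally show ?thesis using S by linarith
qed simp

lemma card_preimage_le:
  assumes "inj_on f V" "f ` V \<subseteq> V" "finite V"
  shows "card {v\<in>V. P (f v)} \<le> card {v\<in>V. P v}"
  by (rule card_inj_on_le[where f = f]) (use assms in \<open>auto intro: inj_on_subset\<close>)

definition (in group) defect :: "'a set \<Rightarrow> 'a set \<Rightarrow> 'v set \<Rightarrow> ('a \<Rightarrow> 'v \<Rightarrow> 'v) \<Rightarrow> ('v \<Rightarrow> 'a \<Rightarrow> nat) \<Rightarrow> 'v set" where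
  "defect W J V \<tau> \<phi> = {v\<in>V. \<exists>s\<in>W. \<exists>g\<in>J. \<phi> (\<tau> s v) g \<noteq> shift G s (\<phi> v) g}"

context toeplitz_metric
begin

text \<open>
  If \<open>\<phi> (\<sigma> s v)\<close> and \<open>s \<phi>(v)\<close> differ in a coordinate from \<open>J\<close>, some \<open>p\<close> in a fixed finite set moves them
  apart by more than \<open>\<kappa>\<close>.  Comparing both \<open>p \<phi>(\<sigma> s v)\<close> and \<open>p s \<phi>(v)\<close> with \<open>\<phi> (\<sigma> (p s) v)\<close> shows that either
  \<open>\<sigma>\<close> fails to be multiplicative at \<open>v\<close>, or one of two distances exceeds \<open>\<kappa> / 2\<close>.  The first is rare
  for a sofic approximation, the second by the inequality of Markov, applied to the mean square distance.
\<close>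

proposition few_defects:
  fixes V :: "nat \<Rightarrow> 'v set"
  assumes sofic: "sofic_approximation G V \<sigma>"
    and W: "finite W" "W \<subseteq> carrier G" and J: "finite J" "J \<subseteq> carrier G" and \<theta>: "\<theta> > 0"
  obtains F \<delta> where "finite F" "F \<subseteq> carrier G" "\<delta> > 0"
    "\<forall>\<^sub>F n in sequentially. \<forall>\<phi>\<in>sofic_maps X (shift G) d F \<delta> (V n) (\<sigma> n).
       real (card (defect W J (V n) (\<sigma> n) \<phi>)) \<le> \<theta> * real (card (V n))"
proof -
  obtain P \<kappa> where P: "finite P" "P \<subseteq> carrier G" "\<kappa> > 0"
    and apart: "\<And>y z g. y \<in> topspace X \<Longrightarrow> z \<in> topspace X \<Longrightarrow> g \<in> J \<Longrightarrow> y g \<noteq> z g \<Longrightarrow>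
       \<exists>p\<in>P. d (shift G p y) (shift G p z) > \<kappa>"
    using apart_if_coordinates_differ[OF J] by metis
  define L where "L = real (card (W \<times> P))"
  define \<theta>' where "\<theta>' = \<theta> / (3 * (L + 1))"
  define c where "c = \<kappa> / 2"
  (* With this value, the inequality of Markov bounds the proportion of large distances by \<theta>'. *)
  define \<delta> where "\<delta> = c * sqrt \<theta>'"
  define F where "F = P \<union> (\<lambda>(s, p). p \<otimes> s) ` (W \<times> P)"
  have L: "L \<ge> 0" by (simp add: L_def)
  have \<theta>': "\<theta>' > 0" using \<theta> L by (simp add: \<theta>'_def)
  have c: "c > 0" using P by (simp add: c_def)
  have \<delta>: "\<delta> > 0" using c \<theta>' by (simp add: \<delta>_def)
  have F: "finite F" "F \<subseteq> carrier G" using P W by (auto simp: F_def)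
  have fin: "\<And>n. finite (V n)" using sofic by (simp add: sofic_approximation_def)
  let ?M = "\<lambda>n q. {v \<in> V n. \<sigma> n (snd q \<otimes> fst q) v \<noteq> \<sigma> n (snd q) (\<sigma> n (fst q) v)}"
  have "\<forall>\<^sub>F n in sequentially. \<forall>q\<in>W \<times> P. real (card (?M n q)) \<le> \<theta>' * real (card (V n))"
  proof (rule eventually_ball_finite)
    show "finite (W \<times> P)" using W P by simp
    show "\<forall>q\<in>W \<times> P. \<forall>\<^sub>F n in sequentially. real (card (?M n q)) \<le> \<theta>' * real (card (V n))"
    proof
      fix q assume "q \<in> W \<times> P"
      then have "snd q \<in> carrier G" "fst q \<in> carrier G" using W P by auto
      then have "(\<lambda>n. real (card {v \<in> V n. \<sigma> n (snd q \<otimes> fst q) v = \<sigma> n (snd q) (\<sigma> n (fst q) v)}) / real (card (V n))) \<longlonglongrightarrow> 1"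
        using sofic unfolding sofic_approximation_def by blast
      from few_exceptions[OF this fin \<theta>']
      show "\<forall>\<^sub>F n in sequentially. real (card (?M n q)) \<le> \<theta>' * real (card (V n))"
        by (rule eventually_mono) auto
    qed
  qed
  then have ev: "\<forall>\<^sub>F n in sequentially. \<forall>\<phi>\<in>sofic_maps X (shift G) d F \<delta> (V n) (\<sigma> n).
       real (card (defect W J (V n) (\<sigma> n) \<phi>)) \<le> \<theta> * real (card (V n))"
  proof (rule eventually_mono, intro ballI)
    fix n \<phi>
    assume M: "\<forall>q\<in>W \<times> P. real (card (?M n q)) \<le> \<theta>' * real (card (V n))"
      and \<phi>: "\<phi> \<in> sofic_maps X (shift G) d F \<delta> (V n) (\<sigma> n)"
    let ?V = "V n" and ?\<sigma> = "\<sigma> n"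
    have \<phi>X: "\<phi> v \<in> topspace X" if "v \<in> ?V" for v using \<phi> that by (auto simp: sofic_maps_def PiE_iff)
    have bij: "bij_betw (?\<sigma> s) ?V ?V" if "s \<in> carrier G" for s
      using sofic_approximation_bij[OF sofic that] .
    have \<sigma>V: "?\<sigma> s v \<in> ?V" if "s \<in> carrier G" "v \<in> ?V" for s v
      using bij_betwE[OF bij[OF that(1)]] that(2) by blast
    let ?D = "\<lambda>t. {v \<in> ?V. d (\<phi> (?\<sigma> t v)) (shift G t (\<phi> v)) > c}"
    have D: "real (card (?D t)) \<le> \<theta>' * real (card ?V)" if "t \<in> F" for t
    proof -
      have "d2 ?V d (\<lambda>v. \<phi> (?\<sigma> t v)) (\<lambda>v. shift G t (\<phi> v)) \<le> \<delta>" using \<phi> that by (auto simp: sofic_maps_def)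
      from d2_markov[OF fin this c] have "real (card (?D t)) * c\<^sup>2 \<le> (\<theta>' * real (card ?V)) * c\<^sup>2"
        using \<theta>' by (simp add: \<delta>_def power_mult_distrib algebra_simps)
      then show ?thesis using c by (simp add: mult_le_cancel_right)
    qed
    let ?D' = "\<lambda>q. {v \<in> ?V. ?\<sigma> (fst q) v \<in> ?D (snd q)}"
    have D': "card (?D' q) \<le> card (?D (snd q))" if "q \<in> W \<times> P" for q
    proof -
      have "fst q \<in> carrier G" using that W by auto
      then have "card {v \<in> ?V. ?\<sigma> (fst q) v \<in> ?D (snd q)} \<le> card {v \<in> ?V. v \<in> ?D (snd q)}"
        using bij[of "fst q"] fin[of n] by (intro card_preimage_le) (auto simp: bij_betw_def)
      also have "{v \<in> ?V. v \<in> ?D (snd q)} = ?D (snd q)" by blast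
      finally show ?thesis .
    qed
    let ?B = "\<lambda>q. ?M n q \<union> ?D' q \<union> ?D (snd q \<otimes> fst q)"
    have "defect W J ?V ?\<sigma> \<phi> \<subseteq> (\<Union>q\<in>W \<times> P. ?B q)"
    proof
      fix v assume "v \<in> defect W J ?V ?\<sigma> \<phi>"
      then obtain s g where v: "v \<in> ?V" "s \<in> W" "g \<in> J" "\<phi> (?\<sigma> s v) g \<noteq> shift G s (\<phi> v) g"
        by (auto simp: defect_def)
      have sG: "s \<in> carrier G" using v(2) W by auto
      have X1: "\<phi> (?\<sigma> s v) \<in> topspace X" using \<phi>X \<sigma>V sG v(1) by blast
      have X2: "shift G s (\<phi> v) \<in> topspace X" using shift_in_orbit_closure[OF x_full_shift sG \<phi>X[OF v(1)]] .
      obtain p where p: "p \<in> P" "d (shift G p (\<phi> (?\<sigma> s v))) (shift G p (shift G s (\<phi> v))) > \<kappa>"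
        using apart[OF X1 X2 v(3,4)] by blast
      have pG: "p \<in> carrier G" using p(1) P by auto
      have "v \<in> ?B (s, p)"
      proof (rule ccontr)
        assume not: "v \<notin> ?B (s, p)"
        define u where "u = ?\<sigma> (p \<otimes> s) v"
        have u: "u = ?\<sigma> p (?\<sigma> s v)" using not v(1) by (auto simp: u_def)
        have 1: "d (\<phi> u) (shift G p (\<phi> (?\<sigma> s v))) \<le> c"
          using not v(1) \<sigma>V[OF sG v(1)] by (auto simp: u)
        have 2: "d (\<phi> u) (shift G p (shift G s (\<phi> v))) \<le> c"
          using not v(1) pG sG by (auto simp: u_def shift_shift)
        have uX: "\<phi> u \<in> topspace X" using \<phi>X \<sigma>V pG sG v(1) unfolding u by blast
        have X3: "shift G p (\<phi> (?\<sigma> s v)) \<in> topspace X" "shift G p (shift G s (\<phi> v)) \<in> topspace X"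
          using shift_in_orbit_closure[OF x_full_shift pG] X1 X2 by auto
        have "d (shift G p (\<phi> (?\<sigma> s v))) (shift G p (shift G s (\<phi> v)))
               \<le> d (shift G p (\<phi> (?\<sigma> s v))) (\<phi> u) + d (\<phi> u) (shift G p (shift G s (\<phi> v)))"
          "d (shift G p (\<phi> (?\<sigma> s v))) (\<phi> u) = d (\<phi> u) (shift G p (\<phi> (?\<sigma> s v)))"
          using d_cont X3 uX unfolding continuous_pseudometric_def by blast+
        then show False using 1 2 p(2) by (simp add: c_def)
      qed
      then show "v \<in> (\<Union>q\<in>W \<times> P. ?B q)" using v(2) p(1) by blast
    qed
    then have "card (defect W J ?V ?\<sigma> \<phi>) \<le> card (\<Union>q\<in>W \<times> P. ?B q)"
      using fin[of n] W P by (intro card_mono) auto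
    also have "\<dots> \<le> (\<Sum>q\<in>W \<times> P. card (?B q))" using W P by (intro card_UN_le) auto
    finally have "real (card (defect W J ?V ?\<sigma> \<phi>)) \<le> real (\<Sum>q\<in>W \<times> P. card (?B q))"
      by (rule of_nat_mono)
    also have "\<dots> = (\<Sum>q\<in>W \<times> P. real (card (?B q)))" by (rule of_nat_sum)
    also have "\<dots> \<le> (\<Sum>q\<in>W \<times> P. 3 * (\<theta>' * real (card ?V)))"
    proof (rule sum_mono)
      fix q assume q: "q \<in> W \<times> P"
      then have "snd q \<in> F" "snd q \<otimes> fst q \<in> F" by (force simp: F_def)+
      note D = D[OF this(1)] D[OF this(2)]
      have "card (?B q) \<le> card (?M n q \<union> ?D' q) + card (?D (snd q \<otimes> fst q))" by (rule card_Un_le)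
      moreover have "card (?M n q \<union> ?D' q) \<le> card (?M n q) + card (?D' q)" by (rule card_Un_le)
      moreover note D'[OF q]
      moreover have "real (card (?M n q)) \<le> \<theta>' * real (card ?V)" using M q by (rule bspec)
      ultimately show "real (card (?B q)) \<le> 3 * (\<theta>' * real (card ?V))" using D by linarith
    qed
    also have "\<dots> = (L / (L + 1)) * (\<theta> * real (card ?V))"
      using L by (simp add: L_def[symmetric] \<theta>'_def divide_simps)
    also have "\<dots> \<le> 1 * (\<theta> * real (card ?V))" using L \<theta> by (intro mult_right_mono) auto
    finally show "real (card (defect W J ?V ?\<sigma> \<phi>)) \<le> \<theta> * real (card ?V)" by simp
  qed
  show thesis by (rule that[OF F \<delta> ev])
qed

end

section \<open>Counting separated models\<close>

text \<open>
  The finite situation at one stage of a sofic approximation: a window \<open>J\<close> as provided by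
  \<open>uniform_witness\<close>, and a finite set \<open>V\<close> with a permutation for each element of a set \<open>S\<close> of group
  elements.
\<close>

locale toeplitz_model = toeplitz_element +
  fixes m :: nat and J :: "'a set" and V :: "'v set" and \<tau> :: "'a \<Rightarrow> 'v \<Rightarrow> 'v" and S :: "'a set"
  assumes J: "finite J" "J \<subseteq> carrier G"
    and witness: "\<And>y w. y \<in> topspace X \<Longrightarrow> w \<in> rcosets H m \<Longrightarrow> y ` w = y ` (J \<inter> w)"
    and same_average: "\<And>y. y \<in> topspace X \<Longrightarrow>
       (\<Sum>w\<in>rcosets H m. ln (real (card (y ` w)))) = (\<Sum>w\<in>rcosets H m. ln (real (card (x ` w))))"
    and V: "finite V"
    and S: "S \<subseteq> carrier G"
    and \<tau>_bij: "\<And>s. s \<in> S \<Longrightarrow> bij_betw (\<tau> s) V V"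
begin

abbreviation "models \<equiv> V \<rightarrow>\<^sub>E topspace X"
abbreviation "bad \<equiv> defect S J V \<tau>"

lemma \<tau>_in: "s \<in> S \<Longrightarrow> v \<in> V \<Longrightarrow> \<tau> s v \<in> V"
  using bij_betwE[OF \<tau>_bij] by blast

lemma model_point: "\<phi> \<in> models \<Longrightarrow> v \<in> V \<Longrightarrow> \<phi> v \<in> topspace X"
  by (rule PiE_mem)

lemma bad_subset: "bad \<phi> \<subseteq> V"
  by (auto simp: defect_def)

lemma not_bad: "v \<in> V \<Longrightarrow> v \<notin> bad \<phi> \<Longrightarrow> s \<in> S \<Longrightarrow> g \<in> J \<Longrightarrow> \<phi> (\<tau> s v) g = shift G s (\<phi> v) g"
  by (auto simp: defect_def)

text \<open>
  Equivariance on the window \<open>J\<close> is enough for the value sets on entire cosets, since they are already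
  attained in the window.
\<close>

lemma values_transport:
  assumes \<phi>: "\<phi> \<in> models" and v: "v \<in> V" "v \<notin> bad \<phi>" and s: "s \<in> S" and w: "w \<in> rcosets H m"
  shows "\<phi> (\<tau> s v) ` w = \<phi> v ` (inv s <# w)"
proof -
  have sG: "s \<in> carrier G" using s S by auto
  have "\<phi> (\<tau> s v) ` w = \<phi> (\<tau> s v) ` (J \<inter> w)"
    by (rule witness[OF model_point[OF \<phi> \<tau>_in[OF s v(1)]] w])
  also have "\<dots> = shift G s (\<phi> v) ` (J \<inter> w)"
    using not_bad[OF v s] by (intro image_cong) auto
  also have "\<dots> = shift G s (\<phi> v) ` w"
    by (rule witness[OF shift_in_orbit_closure[OF x_full_shift sG model_point[OF \<phi> v(1)]] w, symmetric])
  also have "\<dots> = \<phi> v ` (inv s <# w)" by (rule shift_image[OF sG rcosets_subset[OF w]])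
  finally show ?thesis .
qed

lemma values_via_anchor:
  assumes \<phi>: "\<phi> \<in> models" and v: "v \<in> V" "v \<notin> bad \<phi>" and a: "a \<in> V" "a \<notin> bad \<phi>"
    and s: "s \<in> S" and t: "t \<in> S" and meet: "\<tau> s v = \<tau> t a" and w: "w \<in> rcosets H m"
  shows "\<phi> v ` w = \<phi> a ` (inv t <# (s <# w))"
proof -
  interpret N: normal "H m" G by (rule H_normal)
  have G: "s \<in> carrier G" "t \<in> carrier G" using s t S by auto
  have sw: "s <# w \<in> rcosets H m" by (rule N.lcos_rcosets[OF G(1) w])
  have "inv s <# (s <# w) = w" using G rcosets_subset[OF w] by (simp add: lcos_m_assoc lcos_mult_one)
  then have "\<phi> v ` w = \<phi> (\<tau> s v) ` (s <# w)" using values_transport[OF \<phi> v s sw] by simp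
  also have "\<dots> = \<phi> a ` (inv t <# (s <# w))" unfolding meet by (rule values_transport[OF \<phi> a t sw])
  finally show ?thesis .
qed

lemma card_values_bounds:
  assumes "y \<in> topspace X" "w \<in> rcosets H m"
  shows "1 \<le> card (y ` w)" "card (y ` w) \<le> k"
proof -
  interpret N: normal "H m" G by (rule H_normal)
  have w: "w \<noteq> {}" using N.rcosets_non_empty[OF assms(2)] .
  have fin: "finite (y ` w)" using finite_values[OF assms(1) rcosets_subset[OF assms(2)]] .
  then have "card (y ` w) > 0" using w by (subst card_gt_0_iff) auto
  then show "1 \<le> card (y ` w)" by simp
  have "y ` w \<subseteq> {1..k}" using orbit_closure_values[OF assms(1)] rcosets_subset[OF assms(2)] by blast
  then have "card (y ` w) \<le> card {1..k}" by (intro card_mono) auto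
  then show "card (y ` w) \<le> k" by simp
qed

text \<open>
  As \<open>\<tau> s\<close> permutes \<open>V\<close>, the sum is unchanged if \<open>v\<close> is replaced by \<open>\<tau> s v\<close>; at a vertex that is not
  bad this replaces the coset \<open>H m\<close> by its translate under \<open>inv s\<close>.  The choice \<open>s = r w\<close> reaches the
  coset \<open>w\<close>, and the mean over all \<open>w\<close> gives, at each vertex, the average of the point \<open>\<phi> v\<close>, which
  is that of \<open>x\<close>.
\<close>

lemma sum_ln_values_le:
  assumes \<phi>: "\<phi> \<in> models" and r: "\<And>w. w \<in> rcosets H m \<Longrightarrow> r w \<in> S \<and> inv (r w) <# H m = w"
  shows "(\<Sum>v\<in>V. ln (real (card (\<phi> v ` H m)))) \<le>
    real (card V) * ((\<Sum>w\<in>rcosets H m. ln (real (card (x ` w)))) / real (card (rcosets H m)))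
      + real (card (bad \<phi>)) * ln (real k)" (is "?T \<le> real (card V) * (?A / real ?q) + ?B")
proof -
  interpret N: normal "H m" G by (rule H_normal)
  have N: "H m \<in> rcosets H m" by (rule N.subgroup_rcoset)
  have q: "real ?q > 0" using N H_finite_index[of m] by (subst of_nat_0_less_iff, subst card_gt_0_iff) auto
  have lnpos: "ln (real (card (y ` w))) \<ge> 0" "ln (real (card (y ` w))) \<le> ln (real k)"
    if "y \<in> topspace X" "w \<in> rcosets H m" for y w
    using card_values_bounds[OF that] by auto
  have one: "?T \<le> (\<Sum>v\<in>V. ln (real (card (\<phi> v ` w)))) + ?B" if w: "w \<in> rcosets H m" for w
  proof -
    have rS: "r w \<in> S" and rw: "inv (r w) <# H m = w" using r[OF w] by auto
    have "?T = (\<Sum>v\<in>V. ln (real (card (\<phi> (\<tau> (r w) v) ` H m))))"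
      by (rule sum.reindex_bij_betw[OF \<tau>_bij[OF rS], symmetric])
    also have "\<dots> \<le> (\<Sum>v\<in>V. ln (real (card (\<phi> v ` w))) + (if v \<in> bad \<phi> then ln (real k) else 0))"
    proof (rule sum_mono)
      fix v assume v: "v \<in> V"
      show "ln (real (card (\<phi> (\<tau> (r w) v) ` H m))) \<le> ln (real (card (\<phi> v ` w))) + (if v \<in> bad \<phi> then ln (real k) else 0)"
      proof (cases "v \<in> bad \<phi>")
        case True
        then show ?thesis
          using lnpos(1)[OF model_point[OF \<phi> v] w] lnpos(2)[OF model_point[OF \<phi> \<tau>_in[OF rS v]] N] by simp
      next
        case False
        then show ?thesis using values_transport[OF \<phi> v False rS N] rw by simp
      qed
    qed
    also have "\<dots> = (\<Sum>v\<in>V. ln (real (card (\<phi> v ` w)))) + (\<Sum>v\<in>V. if v \<in> bad \<phi> then ln (real k) else 0)"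
      by (rule sum.distrib)
    also have "(\<Sum>v\<in>V. if v \<in> bad \<phi> then ln (real k) else 0) = (\<Sum>v\<in>bad \<phi>. ln (real k))"
      by (rule sum.mono_neutral_cong_right) (use V bad_subset in auto)
    finally show ?thesis by simp
  qed
  have "real ?q * ?T = (\<Sum>w\<in>rcosets H m. ?T)" by simp
  also have "\<dots> \<le> (\<Sum>w\<in>rcosets H m. (\<Sum>v\<in>V. ln (real (card (\<phi> v ` w)))) + ?B)"
    by (rule sum_mono[OF one])
  also have "\<dots> = (\<Sum>w\<in>rcosets H m. \<Sum>v\<in>V. ln (real (card (\<phi> v ` w)))) + real ?q * ?B"
    by (simp add: sum.distrib)
  also have "(\<Sum>w\<in>rcosets H m. \<Sum>v\<in>V. ln (real (card (\<phi> v ` w)))) = (\<Sum>v\<in>V. \<Sum>w\<in>rcosets H m. ln (real (card (\<phi> v ` w))))"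
    by (rule sum.swap)
  also have "\<dots> = (\<Sum>v\<in>V. ?A)" by (intro sum.cong refl same_average model_point[OF \<phi>])
  also have "\<dots> = real (card V) * ?A" by simp
  finally have "real ?q * ?T \<le> real ?q * (real (card V) * (?A / real ?q) + ?B)"
    using q by (simp add: distrib_left)
  then show ?thesis using q by (simp only: mult_le_cancel_left_pos)
qed

text \<open>
  The sparse record of \<open>\<phi>\<close>.  It keeps the window of \<open>\<phi> v\<close> on a prescribed set \<open>C\<close> (anchors and
  vertices with degenerate translates), at the bad vertices, and at those to which information
  might be carried from a bad anchor.
\<close>

definition code :: "'a set \<Rightarrow> 'v set \<Rightarrow> ('v \<Rightarrow> 'a \<Rightarrow> nat) \<Rightarrow> 'v \<Rightarrow> ('a \<Rightarrow> nat) option" where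
  "code W C \<phi> = (\<lambda>v\<in>V. if v \<in> C \<or> v \<in> bad \<phi> \<or> (\<exists>s\<in>W. \<exists>t\<in>W. \<exists>a\<in>bad \<phi>. \<tau> s v = \<tau> t a)
     then Some (restrict (\<phi> v) J) else None)"

abbreviation "symbols \<equiv> insert None (Some ` (J \<rightarrow>\<^sub>E {1..k}))"

lemma code_in: "\<phi> \<in> models \<Longrightarrow> code W C \<phi> \<in> V \<rightarrow>\<^sub>E symbols"
proof -
  assume \<phi>: "\<phi> \<in> models"
  have "restrict (\<phi> v) J \<in> J \<rightarrow>\<^sub>E {1..k}" if v: "v \<in> V" for v
  proof (rule restrict_PiE_iff[THEN iffD2], rule ballI)
    fix g assume "g \<in> J"
    then show "\<phi> v g \<in> {1..k}" using orbit_closure_values[OF model_point[OF \<phi> v]] J(2) by blast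
  qed
  then show ?thesis unfolding code_def by (intro restrict_PiE_iff[THEN iffD2]) auto
qed

lemma card_code_support:
  assumes W: "finite W" "W \<subseteq> S" and C: "C \<subseteq> V"
  shows "card {v\<in>V. code W C \<phi> v \<noteq> None} \<le> card C + (1 + (card W)\<^sup>2) * card (bad \<phi>)"
proof -
  let ?Z = "{v\<in>V. \<exists>s\<in>W. \<exists>t\<in>W. \<exists>a\<in>bad \<phi>. \<tau> s v = \<tau> t a}"
  have fin: "finite C" "finite (bad \<phi>)" "finite ?Z"
    using finite_subset[OF C V] finite_subset[OF bad_subset V] V by auto
  have "{v\<in>V. code W C \<phi> v \<noteq> None} \<subseteq> C \<union> bad \<phi> \<union> ?Z" by (auto simp: code_def)
  then have "card {v\<in>V. code W C \<phi> v \<noteq> None} \<le> card (C \<union> bad \<phi> \<union> ?Z)" using fin by (intro card_mono) auto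
  also have "\<dots> \<le> card (C \<union> bad \<phi>) + card ?Z" by (rule card_Un_le)
  also have "card (C \<union> bad \<phi>) \<le> card C + card (bad \<phi>)" by (rule card_Un_le)
  also have "card ?Z \<le> (card W)\<^sup>2 * card (bad \<phi>)"
    by (rule sparse_tile_overlaps[OF V W(1) _ bad_subset]) (use W(2) \<tau>_bij in \<open>auto simp: bij_betw_def\<close>)
  finally show ?thesis by simp
qed

lemma code_eq_Some:
  assumes "code W C \<phi> = code W C \<psi>" "v \<in> V" "code W C \<phi> v \<noteq> None" "g \<in> J"
  shows "\<phi> v g = \<psi> v g"
proof -
  have 1: "code W C \<phi> v = Some (restrict (\<phi> v) J)" using assms(2,3) by (auto simp: code_def split: if_splits)
  have "code W C \<psi> v \<noteq> None" using assms(1,3) by simp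
  then have 2: "code W C \<psi> v = Some (restrict (\<psi> v) J)" using assms(2) by (auto simp: code_def split: if_splits)
  have "restrict (\<phi> v) J = restrict (\<psi> v) J" using 1 2 assms(1) by simp
  then have "restrict (\<phi> v) J g = restrict (\<psi> v) J g" by simp
  then show ?thesis using assms(4) by simp
qed

text \<open>
  Where the record is silent, \<open>v\<close> and its anchor \<open>a\<close> are bad for neither map, and both maps
  obtain their value sets at \<open>v\<close> from those at \<open>a\<close> by the same formula.
\<close>

lemma code_determines_values:
  assumes W: "W \<subseteq> S" and A: "A \<subseteq> C" and C: "C \<subseteq> V"
    and cover: "\<And>v. v \<in> V - C \<Longrightarrow> \<exists>a\<in>A. \<exists>s\<in>W. \<exists>t\<in>W. \<tau> s v = \<tau> t a"
    and \<phi>: "\<phi> \<in> models" and \<psi>: "\<psi> \<in> models" and eq: "code W C \<phi> = code W C \<psi>"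
    and v: "v \<in> V" and w: "w \<in> rcosets H m"
  shows "\<phi> v ` w = \<psi> v ` w"
proof -
  interpret N: normal "H m" G by (rule H_normal)
  have known: "\<phi> u ` w' = \<psi> u ` w'" if u: "u \<in> V" "code W C \<phi> u \<noteq> None" and w': "w' \<in> rcosets H m" for u w'
  proof -
    have "\<phi> u ` w' = \<phi> u ` (J \<inter> w')" by (rule witness[OF model_point[OF \<phi> u(1)] w'])
    also have "\<dots> = \<psi> u ` (J \<inter> w')" using code_eq_Some[OF eq u] by (intro image_cong) auto
    also have "\<dots> = \<psi> u ` w'" by (rule witness[OF model_point[OF \<psi> u(1)] w', symmetric])
    finally show ?thesis .
  qed
  show ?thesis
  proof (cases "code W C \<phi> v = None")
    case False
    then show ?thesis using known[OF v _ w] by simp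
  next
    case True
    then have True': "code W C \<psi> v = None" using eq by simp
    have out: "v \<notin> C" "v \<notin> bad \<phi>" "\<not> (\<exists>s\<in>W. \<exists>t\<in>W. \<exists>a\<in>bad \<phi>. \<tau> s v = \<tau> t a)"
      using True v by (auto simp: code_def split: if_splits)
    have out': "v \<notin> bad \<psi>" "\<not> (\<exists>s\<in>W. \<exists>t\<in>W. \<exists>a\<in>bad \<psi>. \<tau> s v = \<tau> t a)"
      using True' v by (auto simp: code_def split: if_splits)
    obtain a s t where a: "a \<in> A" "s \<in> W" "t \<in> W" "\<tau> s v = \<tau> t a" using cover v out(1) by blast
    have aV: "a \<in> V" using a(1) A C by auto
    have abad: "a \<notin> bad \<phi>" "a \<notin> bad \<psi>" using out(3) out'(2) a by blast+
    have st: "s \<in> S" "t \<in> S" using a W by auto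
    have G: "s \<in> carrier G" "inv t \<in> carrier G" using st S by auto
    let ?w = "inv t <# (s <# w)"
    have w': "?w \<in> rcosets H m" by (intro N.lcos_rcosets G w)
    have "code W C \<phi> a \<noteq> None" using a(1) A aV by (auto simp: code_def)
    then have "\<phi> a ` ?w = \<psi> a ` ?w" by (rule known[OF aV _ w'])
    moreover have "\<phi> v ` w = \<phi> a ` ?w"
      by (rule values_via_anchor[OF \<phi> v out(2) aV abad(1) st a(4) w])
    moreover have "\<psi> v ` w = \<psi> a ` ?w"
      by (rule values_via_anchor[OF \<psi> v out'(1) aV abad(2) st a(4) w])
    ultimately show ?thesis by simp
  qed
qed

text \<open>
  At a recorded vertex the window is part of the record.  At every other vertex \<open>v\<close>, the symbol of \<open>\<phi> v\<close> at
  \<open>g\<close> is the symbol of \<open>\<phi> (\<tau> (inv g) v)\<close> at \<open>\<one>\<close>.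
\<close>

lemma code_and_symbol_determine_window:
  assumes E: "E \<subseteq> J" "\<And>g. g \<in> E \<Longrightarrow> inv g \<in> S" and one: "\<one> \<in> J"
    and eq: "code W C \<phi> = code W C \<psi>" and sym: "\<And>v. v \<in> V \<Longrightarrow> \<phi> v \<one> = \<psi> v \<one>"
    and v: "v \<in> V" and g: "g \<in> E"
  shows "\<phi> v g = \<psi> v g"
proof (cases "code W C \<phi> v = None")
  case False
  then show ?thesis using code_eq_Some[OF eq v] g E by blast
next
  case True
  then have True': "code W C \<psi> v = None" using eq by simp
  have nb: "v \<notin> bad \<phi>" "v \<notin> bad \<psi>"
    using True True' v by (auto simp: code_def split: if_splits)
  have gS: "inv g \<in> S" and gG: "g \<in> carrier G" using E g J by auto
  have "\<phi> (\<tau> (inv g) v) \<one> = \<phi> v g" "\<psi> (\<tau> (inv g) v) \<one> = \<psi> v g"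
    using not_bad[OF v nb(1) gS one] not_bad[OF v nb(2) gS one] gG by (simp_all add: shift_apply)
  then show ?thesis using sym[OF \<tau>_in[OF gS v]] by simp
qed

text \<open>
  A separated model is determined by its record together with its symbols at \<open>\<one>\<close>.  The records are
  sparse, hence few; given the record, the symbol at each vertex is confined to a known value set, and the
  product of the sizes of these sets is controlled by \<open>sum_ln_values_le\<close>.
\<close>

proposition card_separated_models:
  assumes E: "E \<subseteq> J" "\<And>g. g \<in> E \<Longrightarrow> inv g \<in> S" and one: "\<one> \<in> J"
    and W: "finite W" "W \<noteq> {}" "W \<subseteq> S"
    and r: "\<And>w. w \<in> rcosets H m \<Longrightarrow> r w \<in> S \<and> inv (r w) <# H m = w"
    and U: "real (card {v\<in>V. \<not> inj_on (\<lambda>s. \<tau> s v) W}) \<le> \<beta> * real (card V)"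
    and \<Phi>: "finite \<Phi>" "\<Phi> \<subseteq> models"
    and few_bad: "\<And>\<phi>. \<phi> \<in> \<Phi> \<Longrightarrow> real (card (bad \<phi>)) \<le> \<beta> * real (card V)"
    and sep: "\<And>\<phi> \<psi>. \<phi> \<in> \<Phi> \<Longrightarrow> \<psi> \<in> \<Phi> \<Longrightarrow> \<forall>v\<in>V. \<forall>g\<in>E. \<phi> v g = \<psi> v g \<Longrightarrow> \<phi> = \<psi>"
    and sparse: "real (card {b \<in> V \<rightarrow>\<^sub>E symbols. real (card {v\<in>V. b v \<noteq> None}) \<le> \<theta> * real (card V)})
                   \<le> exp (\<eta> * real (card V))"
    and \<theta>: "1 / real (card W) + \<beta> + (1 + (real (card W))\<^sup>2) * \<beta> \<le> \<theta>"
    and \<beta>: "\<beta> * ln (real k) \<le> \<eta>" and k: "k \<ge> 1"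
  shows "real (card \<Phi>) \<le> exp (((\<Sum>w\<in>rcosets H m. ln (real (card (x ` w)))) / real (card (rcosets H m)) + 2 * \<eta>) * real (card V))"
proof -
  interpret N: normal "H m" G by (rule H_normal)
  have N: "H m \<in> rcosets H m" by (rule N.subgroup_rcoset)
  define a where "a = (\<Sum>w\<in>rcosets H m. ln (real (card (x ` w)))) / real (card (rcosets H m))"
  let ?U = "{v\<in>V. \<not> inj_on (\<lambda>s. \<tau> s v) W}"
  obtain A where A: "A \<subseteq> V - ?U" "card A * card W \<le> card V"
    "\<And>v. v \<in> V - ?U \<Longrightarrow> \<exists>a\<in>A. \<exists>s\<in>W. \<exists>t\<in>W. \<tau> s v = \<tau> t a"
    by (rule maximal_disjoint_translates[OF V W(1,2), of \<tau> ?U]) (use \<tau>_in W(3) in auto)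
  define C where "C = ?U \<union> A"
  have C: "A \<subseteq> C" "C \<subseteq> V" using A(1) by (auto simp: C_def)
  have cover: "\<exists>a\<in>A. \<exists>s\<in>W. \<exists>t\<in>W. \<tau> s v = \<tau> t a" if "v \<in> V - C" for v
    using A(3) that by (auto simp: C_def)
  have Wpos: "real (card W) > 0" using W by (simp add: card_gt_0_iff)
  have cardA: "real (card A) \<le> 1 / real (card W) * real (card V)"
  proof -
    have "real (card A) * real (card W) \<le> real (card V)" using A(2) by (metis of_nat_le_iff of_nat_mult)
    then show ?thesis using Wpos by (simp add: field_simps)
  qed
  have "card C \<le> card ?U + card A" unfolding C_def by (rule card_Un_le)
  then have cardC: "real (card C) \<le> (1 / real (card W) + \<beta>) * real (card V)"
    using cardA U by (simp add: distrib_right)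
  let ?B = "{b \<in> V \<rightarrow>\<^sub>E symbols. real (card {v\<in>V. b v \<noteq> None}) \<le> \<theta> * real (card V)}"
  have finB: "finite ?B"
  proof -
    have "finite (V \<rightarrow>\<^sub>E symbols)" using V J by (intro finite_PiE) (auto intro!: finite_PiE)
    then show ?thesis by simp
  qed
  have codeB: "code W C \<phi> \<in> ?B" if \<phi>: "\<phi> \<in> \<Phi>" for \<phi>
  proof -
    have "real (card {v\<in>V. code W C \<phi> v \<noteq> None}) \<le> real (card C + (1 + (card W)\<^sup>2) * card (bad \<phi>))"
      using card_code_support[OF W(1,3) C(2)] by (rule of_nat_mono)
    also have "\<dots> = real (card C) + (1 + (real (card W))\<^sup>2) * real (card (bad \<phi>))" by (simp add: distrib_right)
    also have "\<dots> \<le> (1 / real (card W) + \<beta>) * real (card V) + (1 + (real (card W))\<^sup>2) * (\<beta> * real (card V))"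
      by (intro add_mono cardC mult_left_mono few_bad[OF \<phi>]) auto
    also have "\<dots> = (1 / real (card W) + \<beta> + (1 + (real (card W))\<^sup>2) * \<beta>) * real (card V)"
      by (simp add: algebra_simps)
    also have "\<dots> \<le> \<theta> * real (card V)" by (rule mult_right_mono[OF \<theta>]) simp
    finally show ?thesis using code_in[OF subsetD[OF \<Phi>(2) \<phi>], of W C] by blast
  qed
  (* Any model \<psi> with record b supplies the value sets for all others. *)
  have fibre: "real (card {\<phi>\<in>\<Phi>. code W C \<phi> = b}) \<le> exp ((a + \<eta>) * real (card V))" for b
  proof (cases "{\<phi>\<in>\<Phi>. code W C \<phi> = b} = {}")
    case True
    show ?thesis unfolding True by simp
  next
    case False
    let ?F = "{\<phi>\<in>\<Phi>. code W C \<phi> = b}"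
    obtain \<psi> where \<psi>: "\<psi> \<in> \<Phi>" "code W C \<psi> = b" using False by auto
    have \<psi>m: "\<psi> \<in> models" using \<psi>(1) \<Phi>(2) by auto
    let ?f = "\<lambda>\<phi>. \<lambda>v\<in>V. \<phi> v \<one>"
    have inj: "inj_on ?f ?F"
    proof (rule inj_onI)
      fix \<phi> \<phi>' assume F: "\<phi> \<in> ?F" "\<phi>' \<in> ?F" and eq: "?f \<phi> = ?f \<phi>'"
      have sym: "\<phi> v \<one> = \<phi>' v \<one>" if "v \<in> V" for v using fun_cong[OF eq, of v] that by simp
      have "code W C \<phi> = code W C \<phi>'" using F by simp
      from code_and_symbol_determine_window[OF E one this sym]
      have "\<forall>v\<in>V. \<forall>g\<in>E. \<phi> v g = \<phi>' v g" by simp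
      then show "\<phi> = \<phi>'" using sep F by simp
    qed
    have img: "?f ` ?F \<subseteq> (\<Pi>\<^sub>E v\<in>V. \<psi> v ` H m)"
    proof
      fix h assume "h \<in> ?f ` ?F"
      then obtain \<phi> where \<phi>: "\<phi> \<in> \<Phi>" "code W C \<phi> = b" "h = ?f \<phi>" by auto
      have \<phi>m: "\<phi> \<in> models" using \<phi>(1) \<Phi>(2) by auto
      have ceq: "code W C \<phi> = code W C \<psi>" using \<phi> \<psi> by simp
      have "\<phi> v \<one> \<in> \<psi> v ` H m" if v: "v \<in> V" for v
      proof -
        have "\<phi> v \<one> \<in> \<phi> v ` H m" by (rule imageI) (rule N.one_closed)
        also have "\<phi> v ` H m = \<psi> v ` H m"
          by (rule code_determines_values[OF W(3) C _ \<phi>m \<psi>m ceq v N]) (rule cover)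
        finally show ?thesis .
      qed
      then show "h \<in> (\<Pi>\<^sub>E v\<in>V. \<psi> v ` H m)" using \<phi>(3) by auto
    qed
    have fin: "finite (\<Pi>\<^sub>E v\<in>V. \<psi> v ` H m)"
      using V finite_values[OF model_point[OF \<psi>m] rcosets_subset[OF N]] by (intro finite_PiE) auto
    have pos: "real (card (\<psi> v ` H m)) > 0" if "v \<in> V" for v
      using card_values_bounds(1)[OF model_point[OF \<psi>m that] N] by simp
    have "card ?F = card (?f ` ?F)" by (rule card_image[OF inj, symmetric])
    also have "\<dots> \<le> card (\<Pi>\<^sub>E v\<in>V. \<psi> v ` H m)" by (rule card_mono[OF fin img])
    also have "\<dots> = (\<Prod>v\<in>V. card (\<psi> v ` H m))" by (rule card_PiE[OF V])
    finally have "real (card ?F) \<le> real (\<Prod>v\<in>V. card (\<psi> v ` H m))" by (rule of_nat_mono)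
    also have "\<dots> = (\<Prod>v\<in>V. exp (ln (real (card (\<psi> v ` H m)))))"
      unfolding of_nat_prod using pos by (intro prod.cong) auto
    also have "\<dots> = exp (\<Sum>v\<in>V. ln (real (card (\<psi> v ` H m))))" by (rule exp_sum[OF V, symmetric])
    also have "\<dots> \<le> exp ((a + \<eta>) * real (card V))"
    proof (subst exp_le_cancel_iff)
      have "(\<Sum>v\<in>V. ln (real (card (\<psi> v ` H m)))) \<le> real (card V) * a + real (card (bad \<psi>)) * ln (real k)"
        unfolding a_def by (rule sum_ln_values_le[OF \<psi>m r])
      also have "real (card (bad \<psi>)) * ln (real k) \<le> (\<beta> * real (card V)) * ln (real k)"
        using k by (intro mult_right_mono few_bad[OF \<psi>(1)]) auto
      also have "(\<beta> * real (card V)) * ln (real k) = (\<beta> * ln (real k)) * real (card V)" by simp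
      also have "\<dots> \<le> \<eta> * real (card V)" by (rule mult_right_mono[OF \<beta>]) simp
      finally show "(\<Sum>v\<in>V. ln (real (card (\<psi> v ` H m)))) \<le> (a + \<eta>) * real (card V)"
        by (simp add: algebra_simps)
    qed
    finally show ?thesis .
  qed
  have "\<Phi> = (\<Union>b\<in>?B. {\<phi>\<in>\<Phi>. code W C \<phi> = b})" using codeB by blast
  then have "card \<Phi> \<le> (\<Sum>b\<in>?B. card {\<phi>\<in>\<Phi>. code W C \<phi> = b})"
    using card_UN_le[OF finB, of "\<lambda>b. {\<phi>\<in>\<Phi>. code W C \<phi> = b}"] by simp
  then have "real (card \<Phi>) \<le> real (\<Sum>b\<in>?B. card {\<phi>\<in>\<Phi>. code W C \<phi> = b})" by (rule of_nat_mono)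
  also have "\<dots> = (\<Sum>b\<in>?B. real (card {\<phi>\<in>\<Phi>. code W C \<phi> = b}))" by (rule of_nat_sum)
  also have "\<dots> \<le> (\<Sum>b\<in>?B. exp ((a + \<eta>) * real (card V)))" by (rule sum_mono[OF fibre])
  also have "\<dots> = real (card ?B) * exp ((a + \<eta>) * real (card V))" by simp
  also have "\<dots> \<le> exp (\<eta> * real (card V)) * exp ((a + \<eta>) * real (card V))"
    by (rule mult_right_mono[OF sparse]) simp
  also have "\<dots> = exp ((a + 2 * \<eta>) * real (card V))" by (simp add: exp_add[symmetric] algebra_simps)
  finally show ?thesis unfolding a_def .
qed

end

section \<open>The entropy bound\<close>

lemma log_separation_number_le:
  assumes bound: "\<And>A. finite A \<Longrightarrow> A \<subseteq> Y \<Longrightarrow> (\<And>y z. y \<in> A \<Longrightarrow> z \<in> A \<Longrightarrow> y \<noteq> z \<Longrightarrow> \<rho> y z > \<epsilon>)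
      \<Longrightarrow> real (card A) \<le> exp (c * N)"
    and N: "N > 0"
  shows "log_enat (separation_number \<epsilon> Y \<rho>) / ereal N \<le> ereal c"
proof -
  define M where "M = nat \<lfloor>exp (c * N)\<rfloor>"
  have "separation_number \<epsilon> Y \<rho> \<le> enat M"
    unfolding separation_number_def
  proof (rule SUP_least)
    fix A assume "A \<in> {A. A \<subseteq> Y \<and> finite A \<and> (\<forall>y\<in>A. \<forall>z\<in>A. y \<noteq> z \<longrightarrow> \<rho> y z > \<epsilon>)}"
    then have "real (card A) \<le> exp (c * N)" by (intro bound) auto
    then show "enat (card A) \<le> enat M" unfolding M_def by (simp add: le_nat_floor)
  qed
  then obtain j where j: "separation_number \<epsilon> Y \<rho> = enat j" "j \<le> M"
    by (cases "separation_number \<epsilon> Y \<rho>") auto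
  show ?thesis
  proof (cases "j = 0")
    case True
    then show ?thesis using j N by (simp add: log_enat_def)
  next
    case False
    have "real j \<le> exp (c * N)" using j(2) unfolding M_def
      by (meson exp_ge_zero le_nat_iff le_floor_iff nat_le_real_less of_int_of_nat_eq of_nat_floor order_trans of_nat_le_iff)
    then have "ln (real j) \<le> ln (exp (c * N))" using False by (subst ln_le_cancel_iff) auto
    then have "ln (real j) \<le> c * N" by simp
    then have "ln (real j) / N \<le> c" using N by (simp add: field_simps)
    then show ?thesis using j False N by (simp add: log_enat_def)
  qed
qed

text \<open>
  Distinct elements of \<open>W\<close> move most vertices to distinct places, and there are finitely many pairs
  of them.
\<close>

lemma few_collisions:
  fixes V :: "nat \<Rightarrow> 'v set"
  assumes sofic: "sofic_approximation G V \<sigma>" and W: "finite W" "W \<subseteq> carrier G" and \<beta>: "\<beta> > 0"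
  shows "\<forall>\<^sub>F n in sequentially. real (card {v\<in>V n. \<not> inj_on (\<lambda>s. \<sigma> n s v) W}) \<le> \<beta> * real (card (V n))"
proof -
  have fin: "\<And>n. finite (V n)" using sofic by (simp add: sofic_approximation_def)
  let ?P = "{p \<in> W \<times> W. fst p \<noteq> snd p}"
  define L where "L = real (card ?P)"
  define \<beta>' where "\<beta>' = \<beta> / (L + 1)"
  have L: "L \<ge> 0" by (simp add: L_def)
  have \<beta>': "\<beta>' > 0" using \<beta> L by (simp add: \<beta>'_def)
  have finP: "finite ?P" using W by simp
  let ?E = "\<lambda>n p. {v \<in> V n. \<not> \<sigma> n (fst p) v \<noteq> \<sigma> n (snd p) v}"
  have "\<forall>\<^sub>F n in sequentially. \<forall>p\<in>?P. real (card (?E n p)) \<le> \<beta>' * real (card (V n))"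
  proof (rule eventually_ball_finite[OF finP], rule ballI)
    fix p assume "p \<in> ?P"
    then have "fst p \<in> carrier G" "snd p \<in> carrier G" "fst p \<noteq> snd p" using W by auto
    then have "(\<lambda>n. real (card {v \<in> V n. \<sigma> n (fst p) v \<noteq> \<sigma> n (snd p) v}) / real (card (V n))) \<longlonglongrightarrow> 1"
      using sofic unfolding sofic_approximation_def by blast
    from few_exceptions[OF this fin \<beta>']
    show "\<forall>\<^sub>F n in sequentially. real (card (?E n p)) \<le> \<beta>' * real (card (V n))"
      by (rule eventually_mono) simp
  qed
  then show ?thesis
  proof (rule eventually_mono)
    fix n assume few: "\<forall>p\<in>?P. real (card (?E n p)) \<le> \<beta>' * real (card (V n))"
    have "{v\<in>V n. \<not> inj_on (\<lambda>s. \<sigma> n s v) W} \<subseteq> (\<Union>p\<in>?P. ?E n p)" by (force simp: inj_on_def)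
    then have "card {v\<in>V n. \<not> inj_on (\<lambda>s. \<sigma> n s v) W} \<le> card (\<Union>p\<in>?P. ?E n p)"
      using finP fin[of n] by (intro card_mono) auto
    also have "\<dots> \<le> (\<Sum>p\<in>?P. card (?E n p))" by (rule card_UN_le[OF finP])
    finally have "real (card {v\<in>V n. \<not> inj_on (\<lambda>s. \<sigma> n s v) W}) \<le> real (\<Sum>p\<in>?P. card (?E n p))"
      by (rule of_nat_mono)
    also have "\<dots> = (\<Sum>p\<in>?P. real (card (?E n p)))" by (rule of_nat_sum)
    also have "\<dots> \<le> (\<Sum>p\<in>?P. \<beta>' * real (card (V n)))" by (rule sum_mono) (use few in blast)
    also have "\<dots> = (L / (L + 1)) * (\<beta> * real (card (V n)))" by (simp add: L_def \<beta>'_def)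
    also have "\<dots> \<le> 1 * (\<beta> * real (card (V n)))" using L \<beta> by (intro mult_right_mono) auto
    finally show "real (card {v\<in>V n. \<not> inj_on (\<lambda>s. \<sigma> n s v) W}) \<le> \<beta> * real (card (V n))" by simp
  qed
qed

context toeplitz_metric
begin

text \<open>
  The parameters are chosen in this order: \<open>E\<close> from \<open>\<epsilon>\<close>, then the window \<open>J\<close>, the admissible
  sparsity \<open>\<theta>\<close>, the size \<open>M\<close> of \<open>W\<close> so that anchors have density below \<open>\<theta> / 3\<close>, the admissible
  proportion \<open>\<beta>\<close> of bad vertices, and finally \<open>F\<close> and \<open>\<delta>\<close> from \<open>few_defects\<close>.
\<close>

theorem sofic_entropy_le_coset_average:
  fixes V :: "nat \<Rightarrow> 'v set"
  assumes sofic: "sofic_approximation G V \<sigma>" and inf: "infinite (carrier G)"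
  shows "sofic_entropy G X (shift G) d V \<sigma>
    \<le> ereal ((\<Sum>w\<in>rcosets H m. ln (real (card (x ` w)))) / real (card (rcosets H m)))" (is "_ \<le> ereal ?a")
  unfolding sofic_entropy_def
proof (rule SUP_least)
  fix \<epsilon> :: real assume "\<epsilon> \<in> {0<..}"
  then have \<epsilon>: "\<epsilon> > 0" by simp
  let ?h = "\<lambda>F \<delta>. limsup (\<lambda>n. log_enat (separation_number \<epsilon> (sofic_maps X (shift G) d F \<delta> (V n) (\<sigma> n)) (dinf (V n) d))
                      / ereal (real (card (V n))))"
  have fin: "\<And>n. finite (V n)" using sofic by (simp add: sofic_approximation_def)
  interpret N: normal "H m" G by (rule H_normal)
  have k: "k \<ge> 1" using orbit_closure_values[OF x_in_orbit_closure one_closed] by auto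
  have "(INF F\<in>{F. finite F \<and> F \<subseteq> carrier G}. INF \<delta>\<in>{0<..}. ?h F \<delta>) \<le> ereal ?a + ereal e" if e: "e > 0" for e
  proof -
    define \<eta> where "\<eta> = e / 2"
    have \<eta>: "\<eta> > 0" using e by (simp add: \<eta>_def)
    obtain E where E: "finite E" "E \<subseteq> carrier G"
      and close: "\<And>y z. y \<in> topspace X \<Longrightarrow> z \<in> topspace X \<Longrightarrow> \<forall>g\<in>E. y g = z g \<Longrightarrow> d y z \<le> \<epsilon>"
      using close_if_coordinates_agree[OF \<epsilon>] by metis
    obtain J0 where J0: "finite J0" "J0 \<subseteq> carrier G"
      "\<And>y w. y \<in> topspace X \<Longrightarrow> w \<in> rcosets H m \<Longrightarrow> y ` w = y ` (J0 \<inter> w)"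
      "\<And>y. y \<in> topspace X \<Longrightarrow>
         (\<Sum>w\<in>rcosets H m. ln (real (card (y ` w)))) = (\<Sum>w\<in>rcosets H m. ln (real (card (x ` w))))"
      using uniform_witness[of m] by metis
    define J where "J = J0 \<union> E \<union> {\<one>}"
    have J: "finite J" "J \<subseteq> carrier G" using J0 E by (auto simp: J_def)
    have wit: "y ` w = y ` (J \<inter> w)" if "y \<in> topspace X" "w \<in> rcosets H m" for y w
    proof
      have "y ` w = y ` (J0 \<inter> w)" by (rule J0(3)[OF that])
      also have "\<dots> \<subseteq> y ` (J \<inter> w)" by (auto simp: J_def)
      finally show "y ` w \<subseteq> y ` (J \<inter> w)" .
    qed auto
    let ?D = "insert None (Some ` (J \<rightarrow>\<^sub>E {1..k}))"
    have finD: "finite ?D" using J by (auto intro!: finite_PiE)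
    obtain \<theta> where \<theta>: "\<theta> > 0"
      "\<forall>V :: 'v set. finite V \<longrightarrow>
         real (card {b \<in> V \<rightarrow>\<^sub>E ?D. real (card {v\<in>V. b v \<noteq> None}) \<le> \<theta> * real (card V)}) \<le> exp (\<eta> * real (card V))"
      using few_sparse_functions[OF finD \<eta>, where z = None] by blast
    obtain M :: nat where M: "real M > 3 / \<theta>" using reals_Archimedean2 by blast
    have "3 / \<theta> > 0" using \<theta>(1) by simp
    then have Mpos: "real M > 0" using M by linarith
    obtain W where W: "finite W" "card W = M" "W \<subseteq> carrier G"
      using infinite_arbitrarily_large[OF inf] by blast
    have Wne: "W \<noteq> {}" using W(2) Mpos by auto
    (* The factor 2 + M^2 counts degenerate translates, bad vertices, and vertices tied to bad anchors;
       the second term absorbs the error in the average, which is at most ln k per bad vertex. *)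
    define \<beta> where "\<beta> = min (\<theta> / (3 * (2 + (real M)\<^sup>2))) (\<eta> / (ln (real k) + 1))"
    have lnk: "ln (real k) \<ge> 0" using k by simp
    have den: "2 + (real M)\<^sup>2 > 0" by (simp add: add_pos_nonneg)
    have \<beta>: "\<beta> > 0" unfolding \<beta>_def using \<theta>(1) \<eta> lnk den by simp
    have "\<beta> * ln (real k) \<le> \<eta> / (ln (real k) + 1) * ln (real k)"
      using lnk by (intro mult_right_mono) (auto simp: \<beta>_def)
    also have "\<dots> \<le> \<eta>" using lnk \<eta> by (simp add: divide_simps)
    finally have \<beta>k: "\<beta> * ln (real k) \<le> \<eta>" .
    have "1 / real M \<le> \<theta> / 3" using M Mpos \<theta>(1) by (simp add: field_simps)
    moreover have "\<beta> * (2 + (real M)\<^sup>2) \<le> \<theta> / (3 * (2 + (real M)\<^sup>2)) * (2 + (real M)\<^sup>2)"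
      using den by (intro mult_right_mono) (auto simp: \<beta>_def)
    moreover have "\<theta> / (3 * (2 + (real M)\<^sup>2)) * (2 + (real M)\<^sup>2) = \<theta> / 3"
    proof -
      have "\<theta> / (3 * c) * c = \<theta> / 3" if "c > 0" for c :: real using that by simp
      from this[OF den] show ?thesis .
    qed
    moreover have "1 / real (card W) + \<beta> + (1 + (real (card W))\<^sup>2) * \<beta> = 1 / real M + \<beta> * (2 + (real M)\<^sup>2)"
      using W(2) by (simp add: algebra_simps)
    ultimately have \<theta>\<beta>: "1 / real (card W) + \<beta> + (1 + (real (card W))\<^sup>2) * \<beta> \<le> \<theta>"
      using \<theta>(1) by linarith
    have "\<exists>s\<in>carrier G. inv s <# H m = w" if w: "w \<in> rcosets H m" for w
    proof -
      obtain b where "b \<in> carrier G" "w = b <# H m" using w N.rcoset_eq_lcos_iff by auto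
      then show ?thesis by (intro bexI[of _ "inv b"]) auto
    qed
    then obtain r where r: "\<And>w. w \<in> rcosets H m \<Longrightarrow> r w \<in> carrier G \<and> inv (r w) <# H m = w" by metis
    (* W serves the anchors, the inverses of E the recovery of the window from symbols, and the image
       of r the averaging over cosets. *)
    define S where "S = W \<union> (\<lambda>g. inv g) ` E \<union> r ` (rcosets H m)"
    have S: "finite S" "S \<subseteq> carrier G" using W E r H_finite_index by (auto simp: S_def)
    obtain F \<delta> where F: "finite F" "F \<subseteq> carrier G" "\<delta> > 0"
      and few: "\<forall>\<^sub>F n in sequentially. \<forall>\<phi>\<in>sofic_maps X (shift G) d F \<delta> (V n) (\<sigma> n).
         real (card (defect S J (V n) (\<sigma> n) \<phi>)) \<le> \<beta> * real (card (V n))"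
      by (rule few_defects[OF sofic S J \<beta>]) (rule that)
    (* Any instance of multiplicativity shows that V n is eventually nonempty. *)
    have "(\<lambda>n. real (card {v \<in> V n. \<sigma> n (\<one> \<otimes> \<one>) v = \<sigma> n \<one> (\<sigma> n \<one> v)}) / real (card (V n))) \<longlonglongrightarrow> 1"
      using sofic one_closed unfolding sofic_approximation_def by blast
    from few_exceptions[OF this fin zero_less_one]
    have ne: "\<forall>\<^sub>F n in sequentially. V n \<noteq> {}" by (rule eventually_mono) simp
    have "?h F \<delta> \<le> ereal (?a + 2 * \<eta>)"
    proof (rule Limsup_bounded)
      show "\<forall>\<^sub>F n in sequentially. log_enat (separation_number \<epsilon> (sofic_maps X (shift G) d F \<delta> (V n) (\<sigma> n)) (dinf (V n) d))
                      / ereal (real (card (V n))) \<le> ereal (?a + 2 * \<eta>)"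
        using few ne few_collisions[OF sofic W(1,3) \<beta>]
      proof eventually_elim
        case (elim n)
        interpret toeplitz_model G k H x m J "V n" "\<sigma> n" S
          by (intro toeplitz_model.intro toeplitz_model_axioms.intro toeplitz_element_axioms J wit J0(4) fin S(2)
              sofic_approximation_bij[OF sofic] subsetD[OF S(2)])
        show ?case
        proof (rule log_separation_number_le)
          show "real (card (V n)) > 0" using elim(2) fin[of n] by (simp add: card_gt_0_iff)
          fix \<Phi> assume \<Phi>: "finite \<Phi>" "\<Phi> \<subseteq> sofic_maps X (shift G) d F \<delta> (V n) (\<sigma> n)"
            and sep: "\<And>\<phi> \<psi>. \<phi> \<in> \<Phi> \<Longrightarrow> \<psi> \<in> \<Phi> \<Longrightarrow> \<phi> \<noteq> \<psi> \<Longrightarrow> dinf (V n) d \<phi> \<psi> > \<epsilon>"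
          have \<Phi>m: "\<Phi> \<subseteq> models" using \<Phi>(2) by (auto simp: sofic_maps_def)
          show "real (card \<Phi>) \<le> exp ((?a + 2 * \<eta>) * real (card (V n)))"
          proof (rule card_separated_models[where E = E and W = W and \<beta> = \<beta> and \<theta> = \<theta> and r = r])
            fix \<phi> \<psi> assume \<phi>: "\<phi> \<in> \<Phi>" "\<psi> \<in> \<Phi>" and agree: "\<forall>v\<in>V n. \<forall>g\<in>E. \<phi> v g = \<psi> v g"
            have "d (\<phi> v) (\<psi> v) \<le> \<epsilon>" if "v \<in> V n" for v
              using agree that \<phi> \<Phi>m by (intro close model_point) auto
            then have "dinf (V n) d \<phi> \<psi> \<le> \<epsilon>"
              unfolding dinf_def using elim(2) fin[of n] by (subst Max_le_iff) auto
            then show "\<phi> = \<psi>" using sep[OF \<phi>] by force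
          next
            show "E \<subseteq> J" "\<one> \<in> J" by (auto simp: J_def)
            show "inv g \<in> S" if "g \<in> E" for g using that by (auto simp: S_def)
            show "W \<subseteq> S" by (auto simp: S_def)
            show "r w \<in> S \<and> inv (r w) <# H m = w" if "w \<in> rcosets H m" for w
              using r[OF that] that by (auto simp: S_def)
            show "real (card (defect S J (V n) (\<sigma> n) \<phi>)) \<le> \<beta> * real (card (V n))" if "\<phi> \<in> \<Phi>" for \<phi>
              using elim(1) that \<Phi>(2) by blast
            show "real (card {b \<in> V n \<rightarrow>\<^sub>E ?D. real (card {v\<in>V n. b v \<noteq> None}) \<le> \<theta> * real (card (V n))})
                   \<le> exp (\<eta> * real (card (V n)))" by (rule \<theta>(2)[rule_format, OF fin])
          qed (use W(1) Wne elim(3) \<Phi>(1) \<Phi>m \<theta>\<beta> \<beta>k k in auto)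
        qed
      qed
    qed
    also have "ereal (?a + 2 * \<eta>) = ereal ?a + ereal e" by (simp add: \<eta>_def)
    finally have "?h F \<delta> \<le> ereal ?a + ereal e" .
    then show ?thesis using F by (intro INF_lower2[of F] INF_lower2[of \<delta>]) auto
  qed
  then show "(INF F\<in>{F. finite F \<and> F \<subseteq> carrier G}. INF \<delta>\<in>{0<..}. ?h F \<delta>) \<le> ereal ?a"
    by (rule ereal_le_epsilon2)
qed

end

theorem theorem7p3:
  fixes G :: "('a, 'b) monoid_scheme" (structure)
    and k :: nat
    and H :: "nat \<Rightarrow> 'a set"
    and x :: "'a \<Rightarrow> nat"
    and d :: "('a \<Rightarrow> nat) \<Rightarrow> ('a \<Rightarrow> nat) \<Rightarrow> real"
  defines "X \<equiv> orbit_closure G k x"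
    and "coset_avg \<equiv> (\<lambda>n. (\<Sum>v\<in>rcosets H n. ln (real (card (x ` v)))) / real (card (rcosets H n)))"
    and "hole_density \<equiv> (\<lambda>n. real (num_holes G (H n) x) / real (card (rcosets H n)))"
  assumes "group G"
    and "countable (carrier G)" and "infinite (carrier G)"
    and "residually_finite G"
    and "k \<ge> 1"
    and "\<And>n. H n \<lhd> G"
    and "\<And>n. finite (rcosets H n)"
    and "decseq H"
    and "(\<Inter>n. H n) = {\<one>}"
    and "x \<in> topspace (full_shift G k)"
    and "toeplitz G H x"
    and "continuous_pseudometric X d"
    and "\<And>y z. y \<in> topspace X \<Longrightarrow> z \<in> topspace X \<Longrightarrow> d y z \<le> 1"
    and "dynamically_generating G X (shift G) d"
  shows "convergent hole_density \<and>
    (\<forall>(V :: nat \<Rightarrow> 'v set) \<sigma>.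
       sofic_approximation_by_homs G V \<sigma> \<and> (\<forall>n. kernel G (BijGroup (V n)) (\<sigma> n) \<subseteq> H n) \<longrightarrow>
         sofic_entropy G X (shift G) d V \<sigma> \<le> liminf (\<lambda>n. ereal (coset_avg n)) \<and>
         liminf (\<lambda>n. ereal (coset_avg n)) \<le> ereal (lim hole_density * ln (real k))) \<and>
    (\<forall>S. finite S \<and> freely_generated G S \<longrightarrow>
       (\<forall>(V :: nat \<Rightarrow> 'v set) \<sigma>.
          sofic_approximation G V \<sigma> \<and> (\<forall>n. stabilizer G S (V n) (\<sigma> n) \<subseteq> H n) \<longrightarrow>
            sofic_entropy G X (shift G) d V \<sigma> \<le> liminf (\<lambda>n. ereal (coset_avg n)) \<and>
            liminf (\<lambda>n. ereal (coset_avg n)) \<le> ereal (lim hole_density * ln (real k))))"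
proof -
  interpret group G by fact
  interpret toeplitz_metric G k H x d
    by (intro toeplitz_metric.intro toeplitz_element.intro toeplitz_element_axioms.intro toeplitz_metric_axioms.intro
      assms[unfolded X_def])
  have entropy: "sofic_entropy G X (shift G) d V \<sigma> \<le> liminf (\<lambda>n. ereal (coset_avg n))"
    if "sofic_approximation G V \<sigma>" for V :: "nat \<Rightarrow> 'v set" and \<sigma>
  proof (rule Liminf_bounded)
    show "\<forall>\<^sub>F n in sequentially. sofic_entropy G X (shift G) d V \<sigma> \<le> ereal (coset_avg n)"
      unfolding X_def coset_avg_def
      by (intro always_eventually allI sofic_entropy_le_coset_average that \<open>infinite (carrier G)\<close>)
  qed
  have dec: "decseq hole_density"
    unfolding hole_density_def
  proof (rule decseq_SucI)
    fix n
    show "real (num_holes G (H (Suc n)) x) / real (card (rcosets H (Suc n)))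
            \<le> real (num_holes G (H n) x) / real (card (rcosets H n))"
      by (intro hole_density_mono H_normal H_finite_index decseq_SucD[OF H_decseq])
  qed
  have "hole_density n \<ge> 0" for n by (simp add: hole_density_def)
  then obtain L where L: "hole_density \<longlonglongrightarrow> L" using decseq_convergent[OF dec] by metis
  then have conv: "convergent hole_density" by (rule convergentI)
  have "x \<in> carrier G \<rightarrow> {1..k}" using x_full_shift by (auto simp: topspace_full_shift PiE_iff)
  then have "(\<Sum>v\<in>rcosets H n. ln (real (card (x ` v)))) \<le> real (num_holes G (H n) x) * ln (real k)" for n
    by (intro sum_ln_card_le_holes H_normal H_finite_index \<open>k \<ge> 1\<close>)
  then have avg: "coset_avg n \<le> hole_density n * ln (real k)" for n
    using divide_right_mono[of _ _ "real (card (rcosets H n))"]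
    by (simp add: coset_avg_def hole_density_def)
  have "(\<lambda>n. ereal (hole_density n * ln (real k))) \<longlonglongrightarrow> ereal (L * ln (real k))"
    using L by (intro tendsto_ereal tendsto_mult_right)
  then have "liminf (\<lambda>n. ereal (hole_density n * ln (real k))) = ereal (lim hole_density * ln (real k))"
    using limI[OF L] by (simp add: lim_imp_Liminf)
  moreover have "liminf (\<lambda>n. ereal (coset_avg n)) \<le> liminf (\<lambda>n. ereal (hole_density n * ln (real k)))"
    using avg by (intro Liminf_mono always_eventually) auto
  ultimately have holes: "liminf (\<lambda>n. ereal (coset_avg n)) \<le> ereal (lim hole_density * ln (real k))" by simp
  show ?thesis
    using conv entropy holes by (auto simp: sofic_approximation_by_homs_def)
qed

end
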